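(* Let $n\ge 2$ and let $P_n$ be the path with vertex set $\{1,\dots,n\}$, vertex $j$ adjacent to $j+1$ for $1\le j\le n-1$. Let $a\in\{1,\dots,n\}$. Proper Laplacian pretty good fractional revival occurs in $P_n$ between the vertices $a$ and $n+1-a$ if and only if one of the following holds: (i) $n=p^{\ell}$ for some prime $p$ and integer $\ell\ge 1$, and $a\neq \frac{p^{\ell}+1}{2}$; (ii) $n=2p^{\ell}$ for some odd prime $p$ and integer $\ell\ge 1$, and $a=\frac{p^{\ell}+1}{2}$ or $a=\frac{3p^{\ell}+1}{2}$.
   Context: For a connected graph $X$ with Laplacian matrix $L=D-A$, let $U(t)=e^{-\mathrm{i}tL}$ for $t\in\mathbb{R}$, and let $\overline{\Gamma}_X$ be the closure of $\{U(t): t\in\mathbb{R}\}$ in the space of complex matrices. $X$ has Laplacian pretty good fractional revival between distinct vertices $a$ and $b$ if $\overline{\Gamma}_X$ contains a matrix $M$ that is block diagonal with respect to the partition $\{a,b\}\cup(V(X)\setminus\{a,b\})$, i.e. $M=\begin{bmatrix} N & 0\\ 0& N'\end{bmatrix}$ with $N$ a $2\times 2$ unitary matrix indexed by $\{a,b\}$. It is proper if such an $M$ can be chosen with $N$ not diagonal. *)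

theory Defs
  imports
    "HOL-Analysis.Analysis"
    "HOL-Computational_Algebra.Primes"
    "Graph_Theory.Graph_Theory"
begin

text \<open>
  A complex matrix with rows and columns indexed by a finite vertex set \<open>V\<close> is a function
  \<open>'a \<Rightarrow> 'a \<Rightarrow> complex\<close> that vanishes outside \<open>V \<times> V\<close>.  On these functions the library topology
  (pointwise convergence) is the usual topology of the finite-dimensional matrix space, and
  they form a closed set, so \<open>closure\<close> is the closure in the space of complex matrices.
\<close>

type_synonym 'a cmatrix = "'a \<Rightarrow> 'a \<Rightarrow> complex"

definition mat_id :: "'a set \<Rightarrow> 'a cmatrix" where
  "mat_id V = (\<lambda>u w. if u \<in> V \<and> u = w then 1 else 0)"

definition mat_prod :: "'a set \<Rightarrow> 'a cmatrix \<Rightarrow> 'a cmatrix \<Rightarrow> 'a cmatrix" where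
  "mat_prod V A B = (\<lambda>u w. if u \<in> V \<and> w \<in> V then \<Sum>x\<in>V. A u x * B x w else 0)"

definition mat_power :: "'a set \<Rightarrow> 'a cmatrix \<Rightarrow> nat \<Rightarrow> 'a cmatrix" where
  "mat_power V A k = (mat_prod V A ^^ k) (mat_id V)"

definition mat_exp :: "'a set \<Rightarrow> 'a cmatrix \<Rightarrow> 'a cmatrix" where
  "mat_exp V A = (\<lambda>u w. \<Sum>k. mat_power V A k u w / fact k)"

definition mat_adj :: "'a cmatrix \<Rightarrow> 'a cmatrix" where
  "mat_adj A = (\<lambda>u w. cnj (A w u))"

text \<open>The submatrix of \<open>A\<close> with rows and columns in \<open>S\<close>.\<close>

definition mat_block :: "'a set \<Rightarrow> 'a cmatrix \<Rightarrow> 'a cmatrix" where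
  "mat_block S A = (\<lambda>u w. if u \<in> S \<and> w \<in> S then A u w else 0)"

definition unitary_on :: "'a set \<Rightarrow> 'a cmatrix \<Rightarrow> bool" where
  "unitary_on V A \<longleftrightarrow>
     mat_prod V A (mat_adj A) = mat_id V \<and> mat_prod V (mat_adj A) A = mat_id V"

definition is_diagonal :: "'a cmatrix \<Rightarrow> bool" where
  "is_diagonal A \<longleftrightarrow> (\<forall>u w. u \<noteq> w \<longrightarrow> A u w = 0)"

text \<open>
  Graphs are the symmetric loop-free digraphs of \<open>Graph_Theory\<close> (locale \<open>pair_graph\<close>): an
  edge is the pair of its two arcs, and the degree of a vertex is its out-degree.
\<close>

definition adjacency_matrix :: "'a pair_pre_digraph \<Rightarrow> 'a cmatrix" where
  "adjacency_matrix X = (\<lambda>u w. if (u, w) \<in> parcs X then 1 else 0)"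

definition degree_matrix :: "'a pair_pre_digraph \<Rightarrow> 'a cmatrix" where
  "degree_matrix X =
     (\<lambda>u w. if u \<in> pverts X \<and> u = w then of_nat (out_degree (with_proj X) u) else 0)"

definition laplacian :: "'a pair_pre_digraph \<Rightarrow> 'a cmatrix" where
  "laplacian X = (\<lambda>u w. degree_matrix X u w - adjacency_matrix X u w)"

definition transition_matrix :: "'a pair_pre_digraph \<Rightarrow> real \<Rightarrow> 'a cmatrix" where
  "transition_matrix X t =
     mat_exp (pverts X) (\<lambda>u w. - \<i> * complex_of_real t * laplacian X u w)"

definition transition_closure :: "'a pair_pre_digraph \<Rightarrow> 'a cmatrix set" where
  "transition_closure X = closure (range (transition_matrix X))"

definition revival_matrix :: "'a pair_pre_digraph \<Rightarrow> 'a \<Rightarrow> 'a \<Rightarrow> 'a cmatrix \<Rightarrow> bool" where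
  "revival_matrix X a b M \<longleftrightarrow>
     M \<in> transition_closure X \<and>
     (\<forall>u\<in>{a, b}. \<forall>w\<in>pverts X - {a, b}. M u w = 0 \<and> M w u = 0) \<and>
     unitary_on {a, b} (mat_block {a, b} M)"

text \<open>
  The two notions below are intended for connected graphs \<open>X\<close>; the path graphs defined below
  are connected by \<open>connected_path_graph\<close>.
\<close>

definition laplacian_PGFR :: "'a pair_pre_digraph \<Rightarrow> 'a \<Rightarrow> 'a \<Rightarrow> bool" where
  "laplacian_PGFR X a b \<longleftrightarrow>
     a \<in> pverts X \<and> b \<in> pverts X \<and> a \<noteq> b \<and> (\<exists>M. revival_matrix X a b M)"

definition proper_laplacian_PGFR :: "'a pair_pre_digraph \<Rightarrow> 'a \<Rightarrow> 'a \<Rightarrow> bool" where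
  "proper_laplacian_PGFR X a b \<longleftrightarrow>
     laplacian_PGFR X a b \<and>
     (\<exists>M. revival_matrix X a b M \<and> \<not> is_diagonal (mat_block {a, b} M))"

definition path_graph :: "nat \<Rightarrow> nat pair_pre_digraph" where
  "path_graph n =
     \<lparr> pverts = {1..n},
       parcs = {(j, j + 1) | j. 1 \<le> j \<and> j + 1 \<le> n} \<union> {(j + 1, j) | j. 1 \<le> j \<and> j + 1 \<le> n} \<rparr>"

lemma pair_graph_path_graph: "pair_graph (path_graph n)"
proof -
  have "parcs (path_graph n) \<subseteq> {1..n} \<times> {1..n}"
    by (auto simp: path_graph_def)
  then have "finite (parcs (path_graph n))"
    by (rule finite_subset) simp
  then show ?thesis
    by unfold_locales (auto simp: path_graph_def symmetric_def intro!: symI)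
qed

lemma connected_path_graph:
  assumes "n \<ge> 1"
  shows "Digraph_Component.connected (with_proj (path_graph n))"
proof -
  let ?G = "with_proj (path_graph n)"
  interpret pair_graph "path_graph n" by (rule pair_graph_path_graph)
  have base: "1 \<rightarrow>\<^sup>*\<^bsub>?G\<^esub> Suc j \<and> Suc j \<rightarrow>\<^sup>*\<^bsub>?G\<^esub> 1" if "Suc j \<le> n" for j
    using that
  proof (induction j)
    case 0
    then show ?case using assms by (auto simp: path_graph_def reachable_def)
  next
    case (Suc j)
    then have "(Suc j, Suc (Suc j)) \<in> parcs (path_graph n)"
      "(Suc (Suc j), Suc j) \<in> parcs (path_graph n)"
      by (auto simp: path_graph_def)
    then show ?case
      using Suc by (meson Suc_leD adj_reachable_trans reachable_adj_trans)
  qed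
  have "strongly_connected ?G"
    unfolding strongly_connected_def
  proof (intro conjI ballI)
    show "verts ?G \<noteq> {}" using assms by (auto simp: path_graph_def)
    fix u v assume "u \<in> verts ?G" "v \<in> verts ?G"
    then have "1 \<le> u" "u \<le> n" "1 \<le> v" "v \<le> n" by (auto simp: path_graph_def)
    then have "u \<rightarrow>\<^sup>*\<^bsub>?G\<^esub> 1" "1 \<rightarrow>\<^sup>*\<^bsub>?G\<^esub> v"
      using base[of "u - 1"] base[of "v - 1"] by auto
    then show "u \<rightarrow>\<^sup>*\<^bsub>?G\<^esub> v" by (rule reachable_trans)
  qed
  then show ?thesis
    unfolding Digraph_Component.connected_def strongly_connected_def
    using reachable_mk_symmetricI by simp
qed

end

theory Submission
  imports Defs "HOL-Number_Theory.Residues"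
begin

text \<open>
  The path has simple Laplacian eigenvalues \<open>\<theta>\<^sub>r = 2 - 2 cos (\<pi> r / n)\<close>, \<open>r < n\<close>, and the reflection
  \<open>a \<mapsto> n + 1 - a\<close> acts on the \<open>r\<close>-th eigenvector by \<open>(-1)\<^sup>r\<close>.  Hence proper revival means that some
  limit of the phases \<open>exp (- \<i> t \<theta>\<^sub>r)\<close> equals \<open>1\<close> at the even and a common \<open>\<zeta> \<noteq> 1\<close> at the odd indices
  \<open>r\<close> whose eigenvector does not vanish at \<open>a\<close>.

  If neither condition holds and \<open>2a \<noteq> n + 1\<close>, integer relations such as \<open>\<theta>\<^sub>s + \<theta>\<^sub>n\<^sub>-\<^sub>s = 4\<close> and
  \<open>\<Sum>j<q. \<theta>\<^bsub>s + 2jn/q\<^esub> = 2q\<close> for primes \<open>q\<close> dividing \<open>n\<close> give \<open>\<zeta>\<^sup>u = \<zeta>\<^sup>v = 1\<close> with coprime \<open>u\<close> and \<open>v\<close>.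

  Conversely, by Kronecker's theorem prescribed phases are a limit as soon as they respect all
  integer relations between the \<open>\<theta>\<^sub>r\<close>.  An integer relation between powers of a root of unity \<open>\<zeta>\<close>
  remains true modulo \<open>p\<close> after \<open>\<zeta>\<close> is replaced by \<open>\<zeta>\<close> raised to a power of \<open>p\<close>.  For \<open>n = p\<^sup>l\<close> and
  \<open>n = 2p\<^sup>l\<close> this shows that \<open>p\<close> divides the sum of the coefficients at the relevant odd indices, so
  \<open>\<zeta>\<close> can be a primitive \<open>p\<close>-th root of unity.
\<close>

subsection \<open>Integer relations and Kronecker approximation\<close>

text \<open>Every commutative ring is treated as a module over the integers:
  \<open>zmod.span\<close> is the additive group generated by a set, and independence is the absence
  of nontrivial integer relations.\<close>

interpretation zmod: Modules.module "\<lambda>(r::int) (x::'a::comm_ring_1). of_int r * x"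
  by (simp add: Modules.module.intro distrib_left distrib_right mult.commute)

text \<open>A finitely generated torsion-free abelian group is free, because a generating set of
  least size is independent. Characteristic 0 supplies torsion-freeness.\<close>

lemma zmod_basis_exists:
  fixes S :: "'a::field_char_0 set"
  assumes "finite S"
  obtains B where "finite B" "zmod.independent B" "zmod.span B = zmod.span S"
proof -
  define P where "P B \<longleftrightarrow> finite B \<and> zmod.span B = zmod.span S" for B
  define k where "k = (LEAST k. \<exists>B. P B \<and> card B = k)"
  have "\<exists>B. P B \<and> card B = k"
    unfolding k_def by (rule LeastI[of _ "card S"]) (use assms in \<open>auto simp: P_def\<close>)
  then obtain B0 where B0: "P B0" "card B0 = k" by blast
  have k_le: "k \<le> card B" if "P B" for B
    unfolding k_def by (rule Least_le) (use that in blast)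
  \<comment> \<open>Among the generating sets of minimal size, a nontrivial relation with minimal coefficient sum is
    made smaller by a step of Euclid's algorithm.\<close>
  define Q where "Q m \<longleftrightarrow> (\<exists>B u. P B \<and> card B = k \<and> (\<exists>v\<in>B. u v \<noteq> (0::int)) \<and>
      (\<Sum>v\<in>B. of_int (u v) * v) = 0 \<and> (\<Sum>v\<in>B. nat \<bar>u v\<bar>) = m)" for m
  have noQ: "\<not> Q m" for m
  proof (induction m rule: less_induct)
    case (less m)
    show ?case
    proof
      assume "Q m"
      then obtain B u v where B: "P B" "card B = k" "v \<in> B" "u v \<noteq> (0::int)"
        and rel: "(\<Sum>v\<in>B. of_int (u v) * v) = 0" and m: "(\<Sum>v\<in>B. nat \<bar>u v\<bar>) = m"
        unfolding Q_def by blast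
      have fin: "finite B" and sp: "zmod.span B = zmod.span S" using B by (auto simp: P_def)
      show False
      proof (cases "\<exists>w\<in>B. w \<noteq> v \<and> u w \<noteq> 0")
        case False
        then have "(\<Sum>v\<in>B. of_int (u v) * v) = of_int (u v) * v"
          using fin B(3) by (subst sum.remove[of _ v]) (auto intro!: sum.neutral)
        then have "v = 0" using rel B by simp
        then have "zmod.span (B - {v}) = zmod.span B"
          unfolding zmod.span_eq by (auto intro: zmod.span_base zmod.span_zero)
        then have "P (B - {v})" using fin sp by (simp add: P_def)
        then show False using k_le[of "B - {v}"] B fin
          by (metis card_Diff1_less not_le)
      next
        case True
        then obtain w where w: "w \<in> B" "w \<noteq> v" "u w \<noteq> 0" by blast
        have "\<exists>x y. x \<in> B \<and> y \<in> B \<and> x \<noteq> y \<and> u x \<noteq> 0 \<and> u y \<noteq> 0 \<and> \<bar>u y\<bar> \<le> \<bar>u x\<bar>"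
          using w B by (cases "\<bar>u w\<bar> \<le> \<bar>u v\<bar>") (auto, metis linear)
        then obtain x y where xy: "x \<in> B" "y \<in> B" "x \<noteq> y" "u x \<noteq> 0" "u y \<noteq> 0" "\<bar>u y\<bar> \<le> \<bar>u x\<bar>"
          by blast
        \<comment> \<open>As
          \<open>u x * x + u y * y = (u x - s * u y) * x + u y * (y + s * x)\<close>, replacing
          \<open>y\<close> by \<open>z\<close> keeps the span and the relation but shrinks the
          coefficient of \<open>x\<close> by \<open>\<bar>u y\<bar>\<close> in absolute
          value.\<close>
        define s where "s = sgn (u x) * sgn (u y)"
        have less: "\<bar>u x - s * u y\<bar> < \<bar>u x\<bar>"
          using xy unfolding s_def by (auto simp: sgn_if split: if_splits)
        define z where "z = y + of_int s * x"
        define C where "C = B - {x, y}"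
        have BC: "B = insert x (insert y C)" "x \<notin> C" "y \<notin> C" "finite C"
          using xy fin by (auto simp: C_def)
        have spz: "zmod.span (insert z (insert x C)) = zmod.span S"
        proof -
          have "z - y \<in> zmod.span (insert x C)"
            using zmod.span_scale[OF zmod.span_base, of x "insert x C" s] by (simp add: z_def)
          from zmod.eq_span_insert_eq[OF this] show ?thesis
            using sp BC by (simp add: insert_commute)
        qed
        \<comment> \<open>A coincidence of \<open>z\<close> with a remaining generator would leave
          fewer than \<open>k\<close> generators.\<close>
        have zn: "z \<notin> insert x C"
        proof
          assume "z \<in> insert x C"
          then have "P (insert x C)" using spz BC by (simp add: P_def insert_absorb)
          from k_le[OF this] show False using B BC xy by simp
        qed
        define B' where "B' = insert z (insert x C)"
        define u' where "u' = u(z := u y, x := u x - s * u y)"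
        have "P B'" using spz BC by (simp add: P_def B'_def)
        have "card B' = k" using zn BC B xy by (simp add: B'_def)
        have u'C: "u' c = u c" if "c \<in> C" for c using that zn BC by (auto simp: u'_def)
        have "(\<Sum>v\<in>B'. of_int (u' v) * v) = of_int (u y) * z + (of_int (u x - s * u y) * x + (\<Sum>v\<in>C. of_int (u v) * v))"
          using zn BC u'C by (simp add: B'_def u'_def)
        also have "\<dots> = (\<Sum>v\<in>B. of_int (u v) * v)"
          using BC xy by (simp add: z_def algebra_simps)
        finally have rel': "(\<Sum>v\<in>B'. of_int (u' v) * v) = 0" using rel by simp
        have "(\<Sum>v\<in>B'. nat \<bar>u' v\<bar>) = nat \<bar>u y\<bar> + (nat \<bar>u x - s * u y\<bar> + (\<Sum>v\<in>C. nat \<bar>u v\<bar>))"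
          using zn BC u'C by (simp add: B'_def u'_def)
        also have "\<dots> < m" using less BC xy unfolding m[symmetric] by simp
        finally have lt: "(\<Sum>v\<in>B'. nat \<bar>u' v\<bar>) < m" .
        have "z \<in> B'" "u' z \<noteq> 0" using zn xy by (auto simp: B'_def u'_def)
        then have "Q (\<Sum>v\<in>B'. nat \<bar>u' v\<bar>)"
          unfolding Q_def using \<open>P B'\<close> \<open>card B' = k\<close> rel' by blast
        with less.IH[OF lt] show False by blast
      qed
    qed
  qed
  have "zmod.independent B0"
  proof
    assume "zmod.dependent B0"
    then obtain u where "\<exists>v\<in>B0. u v \<noteq> (0::int)" "(\<Sum>v\<in>B0. of_int (u v) * v) = 0"
      using B0 by (auto simp: zmod.dependent_finite P_def)
    then have "Q (\<Sum>v\<in>B0. nat \<bar>u v\<bar>)" unfolding Q_def using B0 by blast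
    with noQ show False by blast
  qed
  then show ?thesis using B0 that by (auto simp: P_def)
qed

lemma zmod_span_family:
  fixes f :: "'i \<Rightarrow> 'a::comm_ring_1"
  assumes "finite I" "x \<in> zmod.span (f ` I)"
  obtains c :: "'i \<Rightarrow> int" where "x = (\<Sum>i\<in>I. of_int (c i) * f i)"
proof -
  have "\<exists>c::'i \<Rightarrow> int. x = (\<Sum>i\<in>I. of_int (c i) * f i)"
    using assms(2)
  proof (induction rule: zmod.span_induct_alt)
    case base
    then show ?case by (intro exI[of _ "\<lambda>_. 0"]) simp
  next
    case (step k x y)
    then obtain c :: "'i \<Rightarrow> int" and i where c: "y = (\<Sum>i\<in>I. of_int (c i) * f i)" and i: "i \<in> I" "x = f i"
      by auto
    have "(\<Sum>j\<in>I. of_int ((c(i := c i + k)) j) * f j) = of_int k * x + y"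
      using assms(1) i c by (simp add: sum.remove[of _ i] algebra_simps)
    then show ?case by metis
  qed
  then show ?thesis using that by blast
qed

text \<open>Kronecker's theorem for independent numbers is applied to a basis of the group generated
  by the \<open>\<theta> i\<close>. The hypothesis on relations makes the targets chosen on the
  basis agree with \<open>\<alpha>\<close> modulo 1.\<close>

theorem Kronecker_with_relations:
  fixes \<theta> \<alpha> :: "'i \<Rightarrow> real"
  assumes fin: "finite I"
    and rel: "\<And>c::'i \<Rightarrow> int. (\<Sum>i\<in>I. of_int (c i) * \<theta> i) = 0 \<Longrightarrow> (\<Sum>i\<in>I. of_int (c i) * \<alpha> i) \<in> \<int>"
    and "\<epsilon> > 0"
  obtains t where "\<And>i. i \<in> I \<Longrightarrow> \<exists>h::int. \<bar>t * \<theta> i - of_int h - \<alpha> i\<bar> < \<epsilon>"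
proof -
  obtain B where B: "finite B" "zmod.independent B" "zmod.span B = zmod.span (\<theta> ` I)"
    using zmod_basis_exists[of "\<theta> ` I"] fin by blast
  have "\<exists>c::'i \<Rightarrow> int. b = (\<Sum>i\<in>I. of_int (c i) * \<theta> i)" if "b \<in> B" for b
  proof -
    have "b \<in> zmod.span (\<theta> ` I)" using that B zmod.span_base by blast
    then show ?thesis using zmod_span_family fin by metis
  qed
  then obtain c :: "real \<Rightarrow> 'i \<Rightarrow> int" where c: "\<And>b. b \<in> B \<Longrightarrow> b = (\<Sum>i\<in>I. of_int (c b i) * \<theta> i)"
    by metis
  \<comment> \<open>The target for a basis element copies its expression in the
    \<open>\<theta> i\<close>, with \<open>\<alpha>\<close> in place of
    \<open>\<theta>\<close>.\<close>
  define \<phi> where "\<phi> b = (\<Sum>i\<in>I. of_int (c b i) * \<alpha> i)" for b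
  define d where "d i = zmod.representation B (\<theta> i)" for i
  have d: "\<theta> i = (\<Sum>b\<in>B. of_int (d i b) * b)" if "i \<in> I" for i
    unfolding d_def
    by (rule zmod.sum_representation_eq[symmetric]) (use B that in \<open>auto intro: zmod.span_base\<close>)
  have int: "(\<Sum>b\<in>B. of_int (d i b) * \<phi> b) - \<alpha> i \<in> \<int>" if i: "i \<in> I" for i
  proof -
    \<comment> \<open>Expanding \<open>\<theta> i\<close> in the basis and the basis back in the
      \<open>\<theta> j\<close> gives an integer relation with coefficients \<open>e\<close>;
      \<open>rel\<close> is applied to it.\<close>
    define e where "e j = (\<Sum>b\<in>B. d i b * c b j) - (if j = i then 1 else 0)" for j
    have e: "(\<Sum>j\<in>I. of_int (e j) * f j) = (\<Sum>b\<in>B. of_int (d i b) * (\<Sum>j\<in>I. of_int (c b j) * f j)) - f i"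
      for f :: "'i \<Rightarrow> real"
    proof -
      have "(\<Sum>j\<in>I. of_int (e j) * f j)
          = (\<Sum>j\<in>I. \<Sum>b\<in>B. of_int (d i b) * (of_int (c b j) * f j)) - (\<Sum>j\<in>I. if j = i then f j else 0)"
        unfolding e_def sum_subtractf[symmetric]
        by (intro sum.cong refl) (auto simp: sum_distrib_right algebra_simps sum_distrib_left)
      also have "(\<Sum>j\<in>I. if j = i then f j else 0) = f i" using i fin by simp
      finally show ?thesis by (subst (asm) sum.swap) (simp add: sum_distrib_left)
    qed
    have "(\<Sum>j\<in>I. of_int (e j) * \<theta> j) = 0"
      unfolding e using d[OF i] c by simp
    from rel[OF this] show ?thesis unfolding e \<phi>_def .
  qed
  obtain m g where g: "bij_betw g {..<m::nat} B"
    using ex_bij_betw_nat_finite[OF B(1)] by (auto simp: atLeast0LessThan)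
  \<comment> \<open>A common bound for the loss of precision in passing from the basis to the
    \<open>\<theta> i\<close>; the summand 1 makes it positive and the final estimate
    strict.\<close>
  define D where "D = 1 + (\<Sum>i\<in>I. \<Sum>b\<in>B. \<bar>of_int (d i b)\<bar> :: real)"
  have D: "D > 0" unfolding D_def by (smt (verit) sum_nonneg abs_ge_zero)
  have im: "g ` {..<m} = B" and inj: "inj_on g {..<m}" using g by (auto simp: bij_betw_def)
  obtain t h where th: "\<And>k. k < m \<Longrightarrow> \<bar>t * g k - of_int (h k) - \<phi> (g k)\<bar> < \<epsilon> / D"
    using Kronecker_thm_1[of g m "\<epsilon> / D" "\<lambda>k. \<phi> (g k)"] B(2) im inj \<open>\<epsilon> > 0\<close> D by auto
  define h' where "h' b = h (inv_into {..<m} g b)" for b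
  have th': "\<bar>t * b - of_int (h' b) - \<phi> b\<bar> < \<epsilon> / D" if "b \<in> B" for b
    using th[of "inv_into {..<m} g b"] that im
    by (metis f_inv_into_f h'_def inv_into_into lessThan_iff)
  show ?thesis
  proof
    fix i assume i: "i \<in> I"
    obtain z :: int where z: "(\<Sum>b\<in>B. of_int (d i b) * \<phi> b) - \<alpha> i = of_int z"
      using int[OF i] by (auto elim: Ints_cases)
    have "t * \<theta> i - of_int ((\<Sum>b\<in>B. d i b * h' b) + z) - \<alpha> i
        = (\<Sum>b\<in>B. of_int (d i b) * (t * b - of_int (h' b) - \<phi> b))"
      using z by (simp add: d[OF i] algebra_simps sum.distrib sum_subtractf sum_distrib_left)
    also have "\<bar>\<dots>\<bar> \<le> (\<Sum>b\<in>B. \<bar>of_int (d i b)\<bar> * (\<epsilon> / D))"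
      by (rule order_trans[OF sum_abs], rule sum_mono, unfold abs_mult)
        (intro mult_left_mono less_imp_le[OF th'] abs_ge_zero)
    also have "\<dots> = (\<Sum>b\<in>B. \<bar>of_int (d i b)\<bar>) * (\<epsilon> / D)" by (rule sum_distrib_right[symmetric])
    also have "(\<Sum>b\<in>B. \<bar>of_int (d i b)\<bar>) \<le> (\<Sum>i\<in>I. \<Sum>b\<in>B. \<bar>of_int (d i b)\<bar> :: real)"
      by (rule member_le_sum[OF i _ fin]) (simp add: sum_nonneg)
    then have "(\<Sum>b\<in>B. \<bar>of_int (d i b)\<bar>) * (\<epsilon> / D) < D * (\<epsilon> / D)"
      unfolding D_def[symmetric] using D \<open>\<epsilon> > 0\<close>
      by (intro mult_strict_right_mono) (auto simp: D_def)
    also have "\<dots> = \<epsilon>" using D by simp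
    finally show "\<exists>h::int. \<bar>t * \<theta> i - of_int h - \<alpha> i\<bar> < \<epsilon>" by blast
  qed
qed

section \<open>Divisibility by a prime in the ring generated by a root of unity\<close>

abbreviation int_adjoin :: "complex \<Rightarrow> complex set" where
  "int_adjoin \<zeta> \<equiv> zmod.span (range (\<lambda>i::nat. \<zeta> ^ i))"

lemma int_adjoin_power: "\<zeta> ^ i \<in> int_adjoin \<zeta>"
  by (rule zmod.span_base) simp

lemma int_adjoin_mult:
  assumes "x \<in> int_adjoin \<zeta>" "y \<in> int_adjoin \<zeta>"
  shows "x * y \<in> int_adjoin \<zeta>"
proof -
  have 1: "\<zeta> ^ i * y \<in> int_adjoin \<zeta>" for i
    using assms(2)
  proof (induction rule: zmod.span_induct_alt)
    case base
    then show ?case by (simp add: zmod.span_zero)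
  next
    case (step c x y)
    then obtain j where "x = \<zeta> ^ j" by auto
    then have "\<zeta> ^ i * (of_int c * x + y) = of_int c * \<zeta> ^ (i + j) + \<zeta> ^ i * y"
      by (simp add: power_add algebra_simps)
    then show ?case
      using step zmod.span_add zmod.span_scale int_adjoin_power by metis
  qed
  show ?thesis
    using assms(1)
  proof (induction rule: zmod.span_induct_alt)
    case base
    then show ?case by (simp add: zmod.span_zero)
  next
    case (step c x z)
    then obtain j where "x = \<zeta> ^ j" by auto
    then have "(of_int c * x + z) * y = of_int c * (\<zeta> ^ j * y) + z * y"
      by (simp add: algebra_simps)
    then show ?case
      using step 1 zmod.span_add zmod.span_scale by metis
  qed
qed

lemma int_adjoin_of_int: "of_int k \<in> int_adjoin \<zeta>"
  using zmod.span_scale[OF int_adjoin_power[of \<zeta> 0], of k] by simp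

lemma int_adjoin_pow: "x \<in> int_adjoin \<zeta> \<Longrightarrow> x ^ k \<in> int_adjoin \<zeta>"
  by (induction k) (use int_adjoin_of_int[of 1 \<zeta>] in \<open>auto intro: int_adjoin_mult\<close>)

text \<open>The ring is a free abelian group of finite rank. If it contained \<open>1 / p\<close>,
  every basis element would be \<open>p\<close> times an element of the ring, so its own coordinate
  1 would be divisible by \<open>p\<close>.\<close>

lemma inverse_not_in_int_adjoin:
  assumes \<zeta>: "\<zeta> ^ N = 1" "N > 0" and p: "p > 1"
  shows "1 / of_int p \<notin> int_adjoin \<zeta>"
proof
  assume inv: "1 / of_int p \<in> int_adjoin \<zeta>"
  \<comment> \<open>Exponents matter only modulo \<open>N\<close>, so finitely many powers
    generate.\<close>
  have "\<zeta> ^ i \<in> (\<lambda>i. \<zeta> ^ i) ` {..<N}" for i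
  proof -
    have "\<zeta> ^ i = \<zeta> ^ (i mod N + N * (i div N))" by simp
    also have "\<dots> = \<zeta> ^ (i mod N)" using \<zeta> by (simp only: power_add power_mult) simp
    finally show ?thesis using \<zeta> by auto
  qed
  then have "range (\<lambda>i. \<zeta> ^ i) \<subseteq> (\<lambda>i. \<zeta> ^ i) ` {..<N}" by blast
  then have "finite (range (\<lambda>i. \<zeta> ^ i))" using finite_subset by blast
  then obtain B where B: "finite B" "zmod.independent B" "zmod.span B = int_adjoin \<zeta>"
    using zmod_basis_exists by blast
  have "B \<noteq> {}"
  proof
    assume "B = {}"
    then have "1 \<in> {0::complex}" using B(3) int_adjoin_of_int[of 1 \<zeta>] by (metis of_int_1 zmod.span_empty)
    then show False by simp
  qed
  then obtain b where b: "b \<in> B" by blast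
  then have "b \<in> int_adjoin \<zeta>" using B zmod.span_base by blast
  then have in': "1 / of_int p * b \<in> zmod.span B"
    using int_adjoin_mult[OF inv] B(3) by blast
  have "of_int p * (1 / of_int p * b) = b" using p by simp
  then have "zmod.representation B b b = p * zmod.representation B (1 / of_int p * b) b"
    using zmod.representation_scale[OF B(2) in', of p] by metis
  then have "p dvd 1" using zmod.representation_basis[OF B(2) b] by (metis dvd_triv_left)
  then show False using p by simp
qed

text \<open>An integer divisible by \<open>p\<close> in the larger ring is divisible by
  \<open>p\<close> in the integers: otherwise Bezout's identity would express \<open>1 / p\<close>
  as an element of the ring.\<close>

lemma int_adjoin_rational:
  assumes \<zeta>: "\<zeta> ^ N = 1" "N > 0" and p: "prime (p::nat)"
    and w: "w \<in> int_adjoin \<zeta>" "of_int m = of_nat p * w"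
  shows "int p dvd m"
proof (rule ccontr)
  assume "\<not> int p dvd m"
  then have "coprime (int p) m" using p by (simp add: prime_imp_coprime)
  then obtain x y where xy: "x * int p + y * m = 1"
    using bezout_int[of "int p" m] by (metis coprime_iff_gcd_eq_1)
  have "of_nat p * (of_int x + of_int y * w) = of_int (x * int p + y * m)"
    using w(2) by (simp add: algebra_simps)
  then have "of_nat p * (of_int x + of_int y * w) = 1" using xy by simp
  then have "1 / of_int (int p) = of_int x + of_int y * w"
    using p by (auto simp: field_simps prime_gt_0_nat)
  also have "\<dots> \<in> int_adjoin \<zeta>"
    by (intro zmod.span_add int_adjoin_of_int zmod.span_scale w)
  finally show False
    using inverse_not_in_int_adjoin[OF \<zeta>, of "int p"] prime_gt_1_nat[OF p] by simp
qed

text \<open>The inner binomial coefficients are divisible by \<open>p\<close>; the quotients give an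
  explicit remainder in the ring.\<close>

lemma int_adjoin_freshman:
  assumes p: "prime (p::nat)" and xy: "x \<in> int_adjoin \<zeta>" "y \<in> int_adjoin \<zeta>"
  obtains w where "w \<in> int_adjoin \<zeta>" "(x + y) ^ p = x ^ p + y ^ p + of_nat p * w"
proof
  let ?w = "\<Sum>k\<in>{0<..<p}. of_int (int ((p choose k) div p)) * (x ^ k * y ^ (p - k))"
  show "?w \<in> int_adjoin \<zeta>"
    by (intro zmod.span_sum zmod.span_scale int_adjoin_mult int_adjoin_pow xy)
  have p0: "p > 0" using p by (rule prime_gt_0_nat)
  have "(x + y) ^ p = (\<Sum>k\<le>p. of_nat (p choose k) * x ^ k * y ^ (p - k))"
    by (rule binomial_ring)
  also have "{..p} = insert 0 (insert p {0<..<p})" using p0 by auto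
  also have "(\<Sum>k\<in>insert 0 (insert p {0<..<p}). of_nat (p choose k) * x ^ k * y ^ (p - k))
      = x ^ p + y ^ p + (\<Sum>k\<in>{0<..<p}. of_nat (p choose k) * x ^ k * y ^ (p - k))"
    using p0 by simp
  also have "(\<Sum>k\<in>{0<..<p}. of_nat (p choose k) * x ^ k * y ^ (p - k)) = of_nat p * ?w"
    unfolding sum_distrib_left
  proof (intro sum.cong refl)
    fix k assume "k \<in> {0<..<p}"
    then have "p dvd p choose k" using p by (auto intro: dvd_choose_prime)
    then have "of_nat (p choose k) = (of_nat p * of_nat ((p choose k) div p) :: complex)"
      by (metis dvd_mult_div_cancel of_nat_mult)
    then show "of_nat (p choose k) * x ^ k * y ^ (p - k)
        = of_nat p * (of_int (int ((p choose k) div p)) * (x ^ k * y ^ (p - k)))"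
      by simp
  qed
  finally show "(x + y) ^ p = x ^ p + y ^ p + of_nat p * ?w" .
qed

lemma int_adjoin_freshman_sum:
  assumes p: "prime (p::nat)" and "finite I" and "\<And>i. i \<in> I \<Longrightarrow> x i \<in> int_adjoin \<zeta>"
  shows "\<exists>w \<in> int_adjoin \<zeta>. (\<Sum>i\<in>I. x i) ^ p = (\<Sum>i\<in>I. x i ^ p) + of_nat p * w"
  using assms(2,3)
proof (induction I rule: finite_induct)
  case empty
  then show ?case using prime_gt_0_nat[OF p] by (auto intro!: bexI[of _ 0] simp: zmod.span_zero)
next
  case (insert i I)
  then obtain w where w: "w \<in> int_adjoin \<zeta>" "(\<Sum>i\<in>I. x i) ^ p = (\<Sum>i\<in>I. x i ^ p) + of_nat p * w"
    by auto
  have "x i \<in> int_adjoin \<zeta>" "(\<Sum>i\<in>I. x i) \<in> int_adjoin \<zeta>"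
    using insert by (auto intro: zmod.span_sum)
  from int_adjoin_freshman[OF p this] obtain v where v: "v \<in> int_adjoin \<zeta>"
    "(x i + (\<Sum>i\<in>I. x i)) ^ p = x i ^ p + (\<Sum>i\<in>I. x i) ^ p + of_nat p * v" .
  show ?case
  proof (intro bexI[of _ "v + w"])
    show "(\<Sum>i\<in>insert i I. x i) ^ p = (\<Sum>i\<in>insert i I. x i ^ p) + of_nat p * (v + w)"
      using insert v w by (simp add: algebra_simps)
  qed (use v w zmod.span_add in blast)
qed

text \<open>Fermat's little theorem without coprimality and for integers, obtained by passing to the
  nonnegative residue.\<close>

lemma prime_dvd_power_diff:
  assumes "prime (p::nat)"
  shows "int p dvd c ^ p - c"
proof -
  define a where "a = nat (c mod int p)"
  have a: "[c = int a] (mod int p)" using prime_gt_0_nat[OF assms] by (simp add: a_def cong_def)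
  have "[a ^ p = a] (mod p)"
  proof (cases "p dvd a")
    case True
    then show ?thesis using prime_gt_0_nat[OF assms]
      by (metis cong_0_iff cong_sym cong_trans dvd_power dvd_trans)
  next
    case False
    from cong_mult[OF cong_refl[of a] fermat_theorem[OF assms False]]
    show ?thesis using prime_gt_0_nat[OF assms] by (simp flip: power_Suc)
  qed
  then have "[int a ^ p = int a] (mod int p)" by (metis cong_int_iff of_nat_power)
  then have "[c ^ p = c] (mod int p)" using a by (meson cong_pow cong_sym cong_trans)
  then show ?thesis by (simp add: cong_iff_dvd_diff)
qed

text \<open>Raising to the \<open>p\<close>-th power is additive modulo \<open>p\<close> and fixes
  integer coefficients modulo \<open>p\<close>, so it multiplies all exponents by \<open>p\<close>.
  Iterated from a sum equal to 0, it keeps the sum in the ideal of multiples of \<open>p\<close>,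
  and an integer in that ideal is a multiple of \<open>p\<close>.\<close>

theorem root_of_unity_relation_frobenius:
  fixes c :: "'i \<Rightarrow> int" and \<zeta> :: complex
  assumes \<zeta>: "\<zeta> ^ N = 1" "N > 0" and p: "prime (p::nat)" and I: "finite I"
    and rel: "(\<Sum>i\<in>I. of_int (c i) * \<zeta> ^ e i) = 0"
    and m: "(\<Sum>i\<in>I. of_int (c i) * \<zeta> ^ (e i * p ^ k)) = of_int m"
  shows "int p dvd m"
proof -
  have "\<exists>w \<in> int_adjoin \<zeta>. (\<Sum>i\<in>I. of_int (c i) * \<zeta> ^ (e i * p ^ k)) = of_nat p * w" for k
  proof (induction k)
    case 0
    then show ?case using rel by (auto intro!: bexI[of _ 0] simp: zmod.span_zero)
  next
    case (Suc k)
    let ?x = "\<lambda>i. of_int (c i) * \<zeta> ^ (e i * p ^ k)"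
    obtain w where w: "w \<in> int_adjoin \<zeta>" "(\<Sum>i\<in>I. ?x i) = of_nat p * w" using Suc by blast
    have "\<exists>v \<in> int_adjoin \<zeta>. (\<Sum>i\<in>I. ?x i) ^ p = (\<Sum>i\<in>I. ?x i ^ p) + of_nat p * v"
      by (rule int_adjoin_freshman_sum[OF p I])
        (intro zmod.span_scale int_adjoin_power)
    then obtain v where v: "v \<in> int_adjoin \<zeta>" "(\<Sum>i\<in>I. ?x i) ^ p = (\<Sum>i\<in>I. ?x i ^ p) + of_nat p * v"
      by blast
    \<comment> \<open>By Fermat, the coefficients survive the \<open>p\<close>-th power modulo
      \<open>p\<close>.\<close>
    have "\<exists>d. c i ^ p = c i + int p * d" for i
      using prime_dvd_power_diff[OF p, of "c i"] by (auto simp: dvd_def algebra_simps)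
    then obtain d where d: "\<And>i. c i ^ p = c i + int p * d i" by metis
    let ?u = "\<Sum>i\<in>I. of_int (d i) * \<zeta> ^ (e i * p ^ Suc k)"
    have x: "?x i ^ p = of_int (c i) * \<zeta> ^ (e i * p ^ Suc k) + of_nat p * (of_int (d i) * \<zeta> ^ (e i * p ^ Suc k))" for i
    proof -
      have "?x i ^ p = of_int (c i ^ p) * \<zeta> ^ (e i * p ^ Suc k)"
        by (simp add: power_mult_distrib flip: power_mult) (simp add: mult_ac)
      then show ?thesis unfolding d by (simp add: algebra_simps)
    qed
    have "(\<Sum>i\<in>I. of_int (c i) * \<zeta> ^ (e i * p ^ Suc k)) = (\<Sum>i\<in>I. ?x i ^ p) - of_nat p * ?u"
      unfolding x by (simp only: sum.distrib sum_distrib_left) simp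
    also have "(\<Sum>i\<in>I. ?x i ^ p) = (of_nat p * w) ^ p - of_nat p * v" using v(2) unfolding w(2) by simp
    also have "(of_nat p * w) ^ p = of_nat p * (w * (of_nat p * w) ^ (p - 1))"
      using prime_gt_0_nat[OF p] by (cases p) auto
    finally have "(\<Sum>i\<in>I. of_int (c i) * \<zeta> ^ (e i * p ^ Suc k))
        = of_nat p * (w * (of_int (int p) * w) ^ (p - 1) - v - ?u)"
      by (simp add: algebra_simps)
    moreover have "w * (of_int (int p) * w) ^ (p - 1) - v - ?u \<in> int_adjoin \<zeta>"
      by (intro zmod.span_diff zmod.span_sum zmod.span_scale int_adjoin_mult int_adjoin_pow
          int_adjoin_power int_adjoin_of_int w v)
    ultimately show ?case by blast
  qed
  then show ?thesis using m int_adjoin_rational[OF \<zeta> p] by metis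
qed

subsection \<open>Spectral decomposition of the path\<close>

lemma mat_power_0: "mat_power V A 0 = mat_id V"
  and mat_power_Suc: "mat_power V A (Suc k) = mat_prod V A (mat_power V A k)"
  by (simp_all add: mat_power_def)

lemma mat_power_outside: "u \<notin> V \<or> w \<notin> V \<Longrightarrow> mat_power V A k u w = 0"
  by (cases k) (auto simp: mat_power_0 mat_power_Suc mat_id_def mat_prod_def)

lemma mat_exp_outside: "u \<notin> V \<or> w \<notin> V \<Longrightarrow> mat_exp V A u w = 0"
  by (simp add: mat_exp_def mat_power_outside)

lemma mat_power_left_eigenvector:
  assumes "finite V" "w \<in> V"
    and eig: "\<And>w. w \<in> V \<Longrightarrow> (\<Sum>u\<in>V. f u * A u w) = c * f w"
  shows "(\<Sum>u\<in>V. f u * mat_power V A k u w) = c ^ k * f w"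
proof (induction k)
  case 0
  have "(\<Sum>u\<in>V. f u * mat_power V A 0 u w) = (\<Sum>u\<in>V. if u = w then f u else 0)"
    by (intro sum.cong) (auto simp: mat_power_0 mat_id_def)
  then show ?case using assms by simp
next
  case (Suc k)
  have "(\<Sum>u\<in>V. f u * mat_power V A (Suc k) u w)
      = (\<Sum>u\<in>V. \<Sum>x\<in>V. f u * A u x * mat_power V A k x w)"
    using assms(2) by (intro sum.cong refl) (simp add: mat_power_Suc mat_prod_def sum_distrib_left mult_ac)
  also have "\<dots> = (\<Sum>x\<in>V. (\<Sum>u\<in>V. f u * A u x) * mat_power V A k x w)"
    by (subst sum.swap) (simp add: sum_distrib_right)
  also have "\<dots> = c * (\<Sum>x\<in>V. f x * mat_power V A k x w)"
    by (simp add: eig sum_distrib_left mult_ac)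
  finally show ?case by (simp add: Suc)
qed

text \<open>Abstract spectral data: left eigenvectors \<open>f r\<close> with eigenvalues
  \<open>c r\<close>, and a completeness relation writing the identity on \<open>V\<close> as a
  weighted sum of the rank-one matrices built from them.\<close>

context
  fixes V :: "'a set" and R :: "'r set" and A :: "'a cmatrix"
    and f :: "'r \<Rightarrow> 'a \<Rightarrow> complex" and \<kappa> c :: "'r \<Rightarrow> complex"
  assumes V: "finite V"
    and complete: "\<And>u w. u \<in> V \<Longrightarrow> w \<in> V \<Longrightarrow> (\<Sum>r\<in>R. \<kappa> r * f r u * f r w) = (if u = w then 1 else 0)"
    and eig: "\<And>r w. r \<in> R \<Longrightarrow> w \<in> V \<Longrightarrow> (\<Sum>u\<in>V. f r u * A u w) = c r * f r w"
begin

text \<open>Inserting the completeness relation to the left of the power reduces it to the action on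
  eigenvectors.\<close>

lemma mat_power_spectral:
  assumes u: "u \<in> V" and w: "w \<in> V"
  shows "mat_power V A k u w = (\<Sum>r\<in>R. c r ^ k * (\<kappa> r * f r u * f r w))"
proof -
  have "mat_power V A k u w = (\<Sum>x\<in>V. if x = u then mat_power V A k x w else 0)"
    using u V by simp
  also have "\<dots> = (\<Sum>x\<in>V. (\<Sum>r\<in>R. \<kappa> r * f r u * f r x) * mat_power V A k x w)"
    using u by (intro sum.cong refl) (auto simp: complete)
  also have "\<dots> = (\<Sum>r\<in>R. \<kappa> r * f r u * (\<Sum>x\<in>V. f r x * mat_power V A k x w))"
    by (simp only: sum_distrib_right sum_distrib_left) (subst sum.swap, simp add: mult_ac)
  also have "\<dots> = (\<Sum>r\<in>R. \<kappa> r * f r u * (c r ^ k * f r w))"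
    using mat_power_left_eigenvector[OF V w eig] by (intro sum.cong refl) simp
  finally show ?thesis by (simp add: mult_ac)
qed

text \<open>\<open>mat_exp\<close> is a bare infinite sum, so convergence has to be established; it
  comes from the scalar exponential series of each eigenvalue.\<close>

lemma mat_exp_spectral_sums:
  assumes u: "u \<in> V" and w: "w \<in> V"
  shows "(\<lambda>k. mat_power V A k u w / fact k) sums (\<Sum>r\<in>R. exp (c r) * (\<kappa> r * f r u * f r w))"
proof -
  have "(\<lambda>k. \<Sum>r\<in>R. c r ^ k /\<^sub>R fact k * (\<kappa> r * f r u * f r w))
      sums (\<Sum>r\<in>R. exp (c r) * (\<kappa> r * f r u * f r w))"
    by (intro sums_sum sums_mult2 exp_converges)
  moreover have "(\<Sum>r\<in>R. c r ^ k /\<^sub>R fact k * (\<kappa> r * f r u * f r w)) = mat_power V A k u w / fact k" for k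
    unfolding mat_power_spectral[OF u w] sum_divide_distrib
    by (intro sum.cong refl) (simp add: scaleR_conv_of_real field_simps)
  ultimately show ?thesis by simp
qed

lemma mat_exp_spectral:
  assumes "u \<in> V" "w \<in> V"
  shows "mat_exp V A u w = (\<Sum>r\<in>R. exp (c r) * (\<kappa> r * f r u * f r w))"
  unfolding mat_exp_def using mat_exp_spectral_sums[OF assms] by (rule sums_unique[symmetric])

lemma mat_exp_left_eigenvector:
  assumes r: "r \<in> R" and w: "w \<in> V"
  shows "(\<Sum>u\<in>V. f r u * mat_exp V A u w) = exp (c r) * f r w"
proof -
  have "(\<lambda>k. \<Sum>u\<in>V. f r u * (mat_power V A k u w / fact k)) sums (\<Sum>u\<in>V. f r u * mat_exp V A u w)"
    using mat_exp_spectral_sums w mat_exp_spectral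
    by (intro sums_sum sums_mult) simp
  moreover have "(\<Sum>u\<in>V. f r u * (mat_power V A k u w / fact k)) = c r ^ k /\<^sub>R fact k * f r w" for k
    using mat_power_left_eigenvector[OF V w eig[OF r], of k]
    by (simp add: sum_divide_distrib[symmetric] scaleR_conv_of_real field_simps)
  ultimately have "(\<lambda>k. c r ^ k /\<^sub>R fact k * f r w) sums (\<Sum>u\<in>V. f r u * mat_exp V A u w)" by simp
  moreover have "(\<lambda>k. c r ^ k /\<^sub>R fact k * f r w) sums (exp (c r) * f r w)"
    by (intro sums_mult2 exp_converges)
  ultimately show ?thesis by (rule sums_unique2)
qed

end

section \<open>Laplacian eigenvalues and eigenvectors of the path\<close>

lemma laplacian_path_graph:
  assumes u: "u \<in> {1..n}" and w: "w \<in> {1..n}"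
  shows "laplacian (path_graph n) u w =
    (if w = u then of_bool (1 < u) + of_bool (u < n) else 0)
    - (if w = u - 1 then of_bool (1 < u) else 0) - (if w = u + 1 then of_bool (u < n) else 0)"
proof -
  have "out_arcs (with_proj (path_graph n)) u
      = (if 1 < u then {(u, u - 1)} else {}) \<union> (if u < n then {(u, u + 1)} else {})"
    using u by (auto simp: path_graph_def out_arcs_def split: if_splits)
  then have "out_degree (with_proj (path_graph n)) u = of_bool (1 < u) + of_bool (u < n)"
    by (auto simp: out_degree_def)
  moreover have "(u, w) \<in> parcs (path_graph n) \<longleftrightarrow> (1 < u \<and> w = u - 1) \<or> (u < n \<and> w = u + 1)"
    using u w by (auto simp: path_graph_def)
  ultimately show ?thesis
    using u w by (auto simp: laplacian_def degree_matrix_def adjacency_matrix_def path_graph_def)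
qed

definition path_eigenvalue :: "nat \<Rightarrow> nat \<Rightarrow> real" where
  "path_eigenvalue n r = 2 - 2 * cos (pi * real r / real n)"

text \<open>The vectors of the type II discrete cosine transform. Sampling at \<open>u - 1/2\<close>
  gives equal values at 0 and 1 and at \<open>n\<close> and \<open>n + 1\<close>, which is the
  boundary condition of the Laplacian at the end vertices.\<close>

definition path_eigenvector :: "nat \<Rightarrow> nat \<Rightarrow> nat \<Rightarrow> real" where
  "path_eigenvector n r u = cos (pi * real r * (2 * real u - 1) / (2 * real n))"

text \<open>The addition formula for the cosine handles the inner vertices. At an end, the term of
  the missing neighbour is zero by the reflection symmetry of the cosine, so the same formula holds
  there.\<close>

lemma path_eigenvector_eq:
  assumes n: "n \<ge> 1" and w: "w \<in> {1..n}"
  shows "(\<Sum>u\<in>{1..n}. complex_of_real (path_eigenvector n r u) * laplacian (path_graph n) u w)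
    = of_real (path_eigenvalue n r) * of_real (path_eigenvector n r w)"
proof -
  let ?f = "path_eigenvector n r"
  let ?x = "pi * real r * (2 * real w - 1) / (2 * real n)" and ?h = "pi * real r / real n"
  have L: "laplacian (path_graph n) u w = of_real
      ((if u = w then of_bool (1 < w) + of_bool (w < n) else 0)
      - (if u = w - 1 then of_bool (1 < w) else 0) - (if u = w + 1 then of_bool (w < n) else 0))"
    if "u \<in> {1..n}" for u
    using that w by (subst laplacian_path_graph) auto
  have "(\<Sum>u\<in>{1..n}. complex_of_real (?f u) * laplacian (path_graph n) u w)
    = of_real (\<Sum>u\<in>{1..n}. (if u = w then (of_bool (1 < w) + of_bool (w < n)) * ?f u else 0)
      - (if u = w - 1 then of_bool (1 < w) * ?f u else 0) - (if u = w + 1 then of_bool (w < n) * ?f u else 0))"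
    unfolding of_real_sum
  proof (intro sum.cong refl)
    fix u assume u: "u \<in> {1..n}"
    show "complex_of_real (?f u) * laplacian (path_graph n) u w = of_real
      ((if u = w then (of_bool (1 < w) + of_bool (w < n)) * ?f u else 0)
      - (if u = w - 1 then of_bool (1 < w) * ?f u else 0) - (if u = w + 1 then of_bool (w < n) * ?f u else 0))"
      unfolding L[OF u] of_real_mult[symmetric]
      by (rule arg_cong[of _ _ complex_of_real]) (simp add: right_diff_distrib)
  qed
  also have "(\<Sum>u\<in>{1..n}. (if u = w then (of_bool (1 < w) + of_bool (w < n)) * ?f u else 0)
      - (if u = w - 1 then of_bool (1 < w) * ?f u else 0) - (if u = w + 1 then of_bool (w < n) * ?f u else 0))
    = of_bool (1 < w) * (?f w - ?f (w - 1)) + of_bool (w < n) * (?f w - ?f (w + 1))"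
  proof -
    have "(\<Sum>u\<in>{1..n}. if u = w - 1 then of_bool (1 < w) * ?f u else 0) = of_bool (1 < w) * ?f (w - 1)"
      using w by (subst sum.delta) auto
    moreover have "(\<Sum>u\<in>{1..n}. if u = w + 1 then of_bool (w < n) * ?f u else 0) = of_bool (w < n) * ?f (w + 1)"
      using w by (subst sum.delta) auto
    moreover have "(\<Sum>u\<in>{1..n}. if u = w then (of_bool (1 < w) + of_bool (w < n)) * ?f u else 0)
        = (of_bool (1 < w) + of_bool (w < n)) * ?f w"
      using w by (subst sum.delta) auto
    ultimately show ?thesis unfolding sum_subtractf by (simp only: algebra_simps)
  qed
  also have "of_bool (1 < w) * (?f w - ?f (w - 1)) = cos ?x - cos (?x - ?h)"
  proof (cases "w = 1")
    case True
    have "?x - ?h = - ?x" unfolding True using n by (simp add: field_simps)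
    then show ?thesis using True by simp
  next
    case False
    then have "pi * real r * (2 * real (w - 1) - 1) / (2 * real n) = ?x - ?h"
      using w n by (simp add: field_simps)
    then show ?thesis using False w by (simp add: path_eigenvector_def)
  qed
  also have "of_bool (w < n) * (?f w - ?f (w + 1)) = cos ?x - cos (?x + ?h)"
  proof (cases "w = n")
    case True
    have "?x + ?h = 2 * pi * real r - ?x" unfolding True using n by (simp add: field_simps)
    moreover have "cos (2 * pi * real r - ?x) = cos ?x"
      using cos_int_2pin[of "int r"] sin_int_2pin[of "int r"] by (simp add: cos_diff)
    ultimately have "cos (?x + ?h) = cos ?x" by (simp only:)
    then show ?thesis using True by simp
  next
    case False
    have "pi * real r * (2 * real (w + 1) - 1) / (2 * real n) = ?x + ?h"
      using n by (simp add: field_simps)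
    then show ?thesis using False w by (simp add: path_eigenvector_def)
  qed
  also have "cos ?x - cos (?x - ?h) + (cos ?x - cos (?x + ?h)) = path_eigenvalue n r * ?f w"
    by (simp add: cos_add cos_diff path_eigenvalue_def path_eigenvector_def algebra_simps)
  finally show ?thesis by simp
qed

text \<open>A Dirichlet kernel: multiplied by \<open>sin x\<close> with
  \<open>x = \<pi> s / (2 n)\<close>, the sum telescopes. The condition on \<open>s\<close> ensures
  \<open>sin x \<noteq> 0\<close>.\<close>

lemma sum_cos_half_period:
  fixes s :: int
  assumes n: "n \<ge> 1" and s: "\<not> 2 * int n dvd s"
  shows "1 + 2 * (\<Sum>r=1..<n. cos (pi * real r * of_int s / real n)) = - cos (pi * of_int s)"
proof -
  define x where "x = pi * of_int s / (2 * real n)"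
  have sx: "sin x \<noteq> 0"
  proof
    assume "sin x = 0"
    then obtain i :: int where "x = of_int i * pi" by (auto simp: sin_zero_iff_int2)
    then have "real_of_int s = of_int (2 * int n * i)" using n by (simp add: x_def field_simps)
    then have "s = 2 * int n * i" by (simp only: of_int_eq_iff)
    with s show False by simp
  qed
  have "sin x * (1 + 2 * (\<Sum>r=1..<m. cos (2 * real r * x))) = sin ((2 * real m - 1) * x)" if "m \<ge> 1" for m
    using that
  proof (induction m rule: dec_induct)
    case (step m)
    have "sin x * (1 + 2 * (\<Sum>r=1..<Suc m. cos (2 * real r * x)))
      = sin ((2 * real m - 1) * x) + 2 * sin x * cos (2 * real m * x)"
      using step by (simp add: algebra_simps)
    also have "\<dots> = sin (2 * real m * x + x)"
      by (simp add: left_diff_distrib sin_diff sin_add)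
    finally show ?case by (simp add: algebra_simps)
  qed simp
  from this[OF n] have "sin x * (1 + 2 * (\<Sum>r=1..<n. cos (2 * real r * x))) = sin (pi * of_int s - x)"
  proof -
    have "(2 * real n - 1) * x = pi * of_int s - x" using n by (simp add: x_def field_simps)
    with \<open>sin x * _ = _\<close> show ?thesis by simp
  qed
  also have "\<dots> = sin x * (- cos (pi * of_int s))"
    by (simp add: sin_diff)
  finally have "1 + 2 * (\<Sum>r=1..<n. cos (2 * real r * x)) = - cos (pi * of_int s)"
    by (rule mult_left_cancel[OF sx, THEN iffD1])
  moreover have "2 * real r * x = pi * real r * of_int s / real n" for r
    using n by (simp add: x_def)
  ultimately show ?thesis by simp
qed

text \<open>The reciprocal of the squared norm of the \<open>r\<close>-th eigenvector, for
  \<open>r < n\<close>.\<close>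

definition path_weight :: "nat \<Rightarrow> nat \<Rightarrow> real" where
  "path_weight n r = (if r = 0 then 1 else 2) / real n"

text \<open>Products of cosines turn the sum into Dirichlet kernels at \<open>u - w\<close> and
  \<open>u + w - 1\<close>. These have opposite parity, so the kernels cancel for
  \<open>u \<noteq> w\<close>; for \<open>u = w\<close> they are \<open>2 n - 1\<close> and
  1.\<close>

lemma path_eigenvector_complete:
  assumes n: "n \<ge> 1" and u: "u \<in> {1..n}" and w: "w \<in> {1..n}"
  shows "(\<Sum>r<n. path_weight n r * path_eigenvector n r u * path_eigenvector n r w) = (if u = w then 1 else 0)"
proof -
  let ?c = "\<lambda>s::int. \<lambda>r::nat. cos (pi * real r * of_int s / real n)"
  define D where "D s = 1 + 2 * (\<Sum>r=1..<n. ?c s r)" for s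
  let ?s = "int u - int w" and ?t = "int u + int w - 1"
  have prod: "2 * (path_eigenvector n r u * path_eigenvector n r w) = ?c ?s r + ?c ?t r" for r
  proof -
    let ?a = "pi * real r * (2 * real u - 1) / (2 * real n)" and ?b = "pi * real r * (2 * real w - 1) / (2 * real n)"
    have "?a - ?b = pi * real r * of_int ?s / real n" "?a + ?b = pi * real r * of_int ?t / real n"
      using n by (simp_all add: field_simps)
    then show ?thesis
      unfolding path_eigenvector_def using cos_times_cos[of ?a ?b] by simp
  qed
  have split: "{..<n} = insert 0 {1..<n}" using n by auto
  have "real n * (\<Sum>r<n. path_weight n r * path_eigenvector n r u * path_eigenvector n r w)
      = 1 + (\<Sum>r=1..<n. 2 * (path_eigenvector n r u * path_eigenvector n r w))"
    unfolding split using n by (simp add: path_weight_def path_eigenvector_def algebra_simps sum_distrib_left)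
  also have "\<dots> = (D ?s + D ?t) / 2"
    unfolding prod D_def sum.distrib by (simp add: algebra_simps)
  also have "\<dots> = (if u = w then real n else 0)"
  proof -
    have "\<not> 2 * int n dvd ?t" using u w by (auto dest: zdvd_imp_le)
    then have t: "D ?t = - cos (pi * of_int ?t)" unfolding D_def by (rule sum_cos_half_period[OF n])
    show ?thesis
    proof (cases "u = w")
      case True
      have "cos (pi * of_int ?t) = - 1"
        using True cos_npi_int[of ?t] by simp
      then show ?thesis using True t n by (simp add: D_def)
    next
      case False
      have "\<not> 2 * int n dvd ?s" using dvd_imp_le_int[of ?s "2 * int n"] u w False by auto
      then have s: "D ?s = - cos (pi * of_int ?s)" unfolding D_def by (rule sum_cos_half_period[OF n])
      have "even ?s \<longleftrightarrow> odd ?t" by presburger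
      then have "cos (pi * of_int ?s) + cos (pi * of_int ?t) = 0"
        by (simp only: cos_npi_int) simp
      then show ?thesis using False s t by simp
    qed
  qed
  finally show ?thesis using n by (simp add: field_simps split: if_splits)
qed

text \<open>The entrywise formula serves to construct revival, the eigenvector identity to extract
  single phases from a given revival matrix.\<close>

lemma
  assumes n: "n \<ge> 1"
  shows transition_matrix_path_graph: "\<And>u w. u \<in> {1..n} \<Longrightarrow> w \<in> {1..n} \<Longrightarrow>
      transition_matrix (path_graph n) t u w = (\<Sum>r<n. cis (- t * path_eigenvalue n r) *
        of_real (path_weight n r * path_eigenvector n r u * path_eigenvector n r w))" (is "PROP ?P1")
    and transition_matrix_left_eigenvector: "\<And>r w. r < n \<Longrightarrow> w \<in> {1..n} \<Longrightarrow>
      (\<Sum>u\<in>{1..n}. of_real (path_eigenvector n r u) * transition_matrix (path_graph n) t u w)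
      = cis (- t * path_eigenvalue n r) * of_real (path_eigenvector n r w)" (is "PROP ?P2")
proof -
  let ?A = "\<lambda>u w. - \<i> * complex_of_real t * laplacian (path_graph n) u w"
  let ?f = "\<lambda>r u. complex_of_real (path_eigenvector n r u)"
  let ?\<kappa> = "\<lambda>r. complex_of_real (path_weight n r)"
  let ?c = "\<lambda>r. - \<i> * complex_of_real (t * path_eigenvalue n r)"
  have V: "pverts (path_graph n) = {1..n}" by (simp add: path_graph_def)
  have compl: "(\<Sum>r<n. ?\<kappa> r * ?f r u * ?f r w) = (if u = w then 1 else 0)"
    if "u \<in> {1..n}" "w \<in> {1..n}" for u w
    using path_eigenvector_complete[OF n that]
    by (simp flip: of_real_mult of_real_sum)
  have eig: "(\<Sum>u\<in>{1..n}. ?f r u * ?A u w) = ?c r * ?f r w" if "r \<in> {..<n}" "w \<in> {1..n}" for r w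
  proof -
    have "(\<Sum>u\<in>{1..n}. ?f r u * ?A u w)
      = (- \<i> * of_real t) * (\<Sum>u\<in>{1..n}. ?f r u * laplacian (path_graph n) u w)"
      by (simp add: sum_distrib_left mult_ac)
    then show ?thesis using path_eigenvector_eq[OF n that(2)] by simp
  qed
  have cis: "cis (- t * path_eigenvalue n r) = exp (?c r)" for r
    by (simp add: cis_conv_exp)
  show "PROP ?P1"
    unfolding transition_matrix_def V cis of_real_mult[of "_ * _"]
    using mat_exp_spectral[OF finite_atLeastAtMost compl eig] by simp
  show "PROP ?P2"
    unfolding transition_matrix_def V cis
    using mat_exp_left_eigenvector[OF finite_atLeastAtMost compl eig] by simp
qed

lemma path_eigenvector_reflect:
  assumes "n \<ge> 1" "a \<in> {1..n}"
  shows "path_eigenvector n r (n + 1 - a) = (- 1) ^ r * path_eigenvector n r a"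
proof -
  let ?x = "pi * real r * (2 * real a - 1) / (2 * real n)"
  have "pi * real r * (2 * real (n + 1 - a) - 1) / (2 * real n) = real r * pi - ?x"
    using assms by (simp add: field_simps)
  then show ?thesis by (simp add: path_eigenvector_def cos_diff)
qed

text \<open>The cosine vanishes exactly at odd multiples of \<open>\<pi> / 2\<close>, which makes
  the support of \<open>a\<close> in the spectrum an arithmetic condition.\<close>

lemma path_eigenvector_eq_0_iff:
  assumes "n \<ge> 1" "a \<ge> 1"
  shows "path_eigenvector n r a = 0 \<longleftrightarrow> (\<exists>i. odd i \<and> r * (2 * a - 1) = i * n)"
proof -
  have eq: "pi * real r * (2 * real a - 1) / (2 * real n) = of_int i * (pi / 2) \<longleftrightarrow> int (r * (2 * a - 1)) = i * int n" for i
  proof -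
    have "pi * real r * (2 * real a - 1) / (2 * real n) = of_int i * (pi / 2) \<longleftrightarrow>
        pi * (real r * (2 * real a - 1)) = pi * (of_int i * real n)"
    proof -
      have 1: "pi * real r * (2 * real a - 1) = pi * (real r * (2 * real a - 1))" by simp
      have 2: "of_int i * (pi / 2) = pi * (of_int i * real n) / (2 * real n)" using assms by simp
      show ?thesis unfolding 1 2 using assms by (subst divide_cancel_right) simp
    qed
    also have "\<dots> \<longleftrightarrow> real r * (2 * real a - 1) = of_int i * real n"
      by (rule mult_left_cancel) simp
    also have "\<dots> \<longleftrightarrow> real_of_int (int (r * (2 * a - 1))) = real_of_int (i * int n)"
      using assms by (simp add: of_nat_diff)
    finally show ?thesis by (simp only: of_int_eq_iff)
  qed
  have "path_eigenvector n r a = 0 \<longleftrightarrow> (\<exists>i::int. odd i \<and> int (r * (2 * a - 1)) = i * int n)"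
    unfolding path_eigenvector_def cos_zero_iff_int eq ..
  also have "\<dots> \<longleftrightarrow> (\<exists>i. odd i \<and> r * (2 * a - 1) = i * n)"
  proof
    assume "\<exists>i::int. odd i \<and> int (r * (2 * a - 1)) = i * int n"
    then obtain i :: int where i: "odd i" "int (r * (2 * a - 1)) = i * int n" by blast
    then have "0 \<le> i * int n" by (metis of_nat_0_le_iff)
    then have "i \<ge> 0" using assms(1) by (simp add: zero_le_mult_iff)
    then show "\<exists>i. odd i \<and> r * (2 * a - 1) = i * n"
      using i by (intro exI[of _ "nat i"]) (auto simp: even_nat_iff nat_mult_distrib simp flip: of_nat_eq_iff[where 'a=int])
  next
    assume "\<exists>i. odd i \<and> r * (2 * a - 1) = i * n"
    then obtain i where "odd i" "r * (2 * a - 1) = i * n" by blast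
    then show "\<exists>i::int. odd i \<and> int (r * (2 * a - 1)) = i * int n"
      by (intro exI[of _ "int i"]) (simp flip: of_nat_mult)
  qed
  finally show ?thesis .
qed

lemma tendsto_fun_iff:
  fixes f :: "'x \<Rightarrow> 'a \<Rightarrow> 'b::topological_space"
  shows "(f \<longlongrightarrow> l) F \<longleftrightarrow> (\<forall>i. ((\<lambda>x. f x i) \<longlongrightarrow> l i) F)"
  using limitin_componentwise[of "\<lambda>_::'a. euclidean :: 'b topology" UNIV f l F]
  by (simp add: euclidean_product_topology)

subsection \<open>Necessity\<close>

lemma not_prime_power_two_primes:
  fixes n :: nat
  assumes "n \<ge> 2" and npp: "\<not> (\<exists>p l. prime p \<and> l \<ge> 1 \<and> n = p ^ l)"
  obtains p q where "prime p" "prime q" "p \<noteq> q" "p dvd n" "q dvd n"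
proof -
  obtain p where p: "prime p" "p dvd n" using prime_factor_nat[of n] assms(1) by auto
  obtain y where y: "n = p ^ multiplicity p n * y" "\<not> p dvd y"
  proof -
    have "n \<noteq> 0" "\<not> is_unit p" using assms(1) p by auto
    then show ?thesis using that multiplicity_decompose'[of n p] by blast
  qed
  have "multiplicity p n \<ge> 1" using p assms(1) by (simp add: Suc_leI prime_multiplicity_gt_zero_iff)
  then have "y \<noteq> 1" using npp p(1) y(1) by auto
  then obtain q where q: "prime q" "q dvd y" using prime_factor_nat by blast
  have "q dvd n" using q(2) y(1) by (metis dvd_mult)
  then show ?thesis using that[of p q] p q y(2) by blast
qed

lemma eq_1_if_coprime_powers:
  fixes z :: "'a::field"
  assumes "z ^ p = 1" "z ^ q = 1" "coprime p q" "p > 0"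
  shows "z = 1"
proof -
  obtain x y where xy: "p * x = q * y + 1"
    using bezout_nat[of p q] assms by (auto simp: coprime_iff_gcd_eq_1)
  have "1 = z ^ (p * x)" using assms(1) by (simp add: power_mult)
  also have "\<dots> = (z ^ q) ^ y * z" unfolding xy by (simp add: power_mult)
  finally show ?thesis using assms(2) by simp
qed

section \<open>Integer relations between the eigenvalues\<close>

lemma sum_cos_translates:
  assumes "q \<ge> 2"
  shows "(\<Sum>j<q. cos (x + 2 * pi * real j / real q)) = 0"
proof -
  define w where "w = cis (2 * pi / real q)"
  have "w \<noteq> 1"
  proof
    assume "w = 1"
    then have "cos (2 * pi / real q) = 1" by (auto simp: w_def complex_eq_iff)
    then obtain i :: int where "2 * pi / real q = of_int i * 2 * pi" by (auto simp: cos_one_2pi_int)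
    then have "real_of_int (int q * i) = 1" using assms by (simp add: field_simps)
    then have "int q * i = 1" by linarith
    then have "int q dvd 1" by (rule dvdI[OF sym])
    then show False using assms by simp
  qed
  moreover have "w ^ q = 1" unfolding w_def Complex.DeMoivre using assms by simp
  ultimately have "(\<Sum>j<q. w ^ j) = 0" by (simp add: geometric_sum)
  then have "(\<Sum>j<q. cis x * w ^ j) = 0" by (simp flip: sum_distrib_left)
  moreover have "cis x * w ^ j = cis (x + 2 * pi * real j / real q)" for j
    by (simp add: w_def Complex.DeMoivre cis_mult mult_ac)
  ultimately have "Re (\<Sum>j<q. cis (x + 2 * pi * real j / real q)) = 0" by simp
  then show ?thesis by simp
qed

lemma path_eigenvalue_pair:
  assumes "n \<ge> 1" "s \<le> n"
  shows "path_eigenvalue n s + path_eigenvalue n (n - s) = 4"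
proof -
  have "pi * real (n - s) / real n = pi - pi * real s / real n"
    using assms by (simp add: of_nat_diff field_simps)
  then show ?thesis by (simp add: path_eigenvalue_def)
qed

lemma path_eigenvalue_half:
  assumes "n \<ge> 1" "even n"
  shows "path_eigenvalue n (n div 2) = 2"
proof -
  obtain k where k: "n = 2 * k" using assms by (auto elim: evenE)
  then have "pi * real (n div 2) / real n = pi / 2" using assms by (simp add: field_simps)
  then show ?thesis by (simp only: path_eigenvalue_def) simp
qed

text \<open>Translates of an index run up to \<open>2 n\<close>; folding brings them back below
  \<open>n\<close> and preserves parity.\<close>

lemma path_eigenvalue_fold:
  assumes "n \<ge> 1" "s \<le> 2 * n"
  shows "path_eigenvalue n (2 * n - s) = path_eigenvalue n s"
proof -
  have "pi * real (2 * n - s) / real n = 2 * pi - pi * real s / real n"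
    using assms by (simp add: of_nat_diff field_simps)
  then show ?thesis by (simp add: path_eigenvalue_def)
qed

lemma path_eigenvalue_translates:
  assumes "n \<ge> 1" "q dvd n" "q \<ge> 2"
  shows "(\<Sum>j<q. path_eigenvalue n (s + 2 * j * (n div q))) = 2 * real q"
proof -
  have "pi * real (s + 2 * j * (n div q)) / real n = pi * real s / real n + 2 * pi * real j / real q" for j
    using assms by (simp add: field_simps real_of_nat_div)
  then show ?thesis
    using sum_cos_translates[OF assms(3), of "pi * real s / real n"]
    by (simp add: path_eigenvalue_def sum_subtractf flip: sum_distrib_left)
qed

lemma path_eigenvector_fold:
  assumes "n \<ge> 1" "a \<ge> 1" "s \<le> 2 * n"
  shows "path_eigenvector n (2 * n - s) a = 0 \<longleftrightarrow> path_eigenvector n s a = 0"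
proof -
  let ?x = "pi * real s * (2 * real a - 1) / (2 * real n)"
  have "pi * real (2 * n - s) * (2 * real a - 1) / (2 * real n) = real (2 * a - 1) * pi - ?x"
    using assms by (simp add: of_nat_diff field_simps)
  then show ?thesis by (simp add: path_eigenvector_def cos_diff)
qed

section \<open>Phase limits forced by revival\<close>

text \<open>Columns \<open>a\<close> and \<open>n + 1 - a\<close> of \<open>M\<close> vanish outside
  these two rows. Multiplying by the \<open>r\<close>-th eigenvector from the left therefore leaves
  two terms, related by the reflection sign, and division by a nonzero entry isolates the limit of
  the phase.\<close>

lemma revival_phases:
  assumes n: "n \<ge> 1" and a: "a \<in> {1..n}" and ab: "a \<noteq> n + 1 - a"
    and M: "revival_matrix (path_graph n) a (n + 1 - a) M"
  obtains t where
    "\<And>r. r < n \<Longrightarrow> path_eigenvector n r a \<noteq> 0 \<Longrightarrow>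
      (\<lambda>k. cis (- t k * path_eigenvalue n r)) \<longlonglongrightarrow> M a a + (- 1) ^ r * M (n + 1 - a) a"
    "\<And>r. r < n \<Longrightarrow> path_eigenvector n r a \<noteq> 0 \<Longrightarrow>
      (\<lambda>k. cis (- t k * path_eigenvalue n r)) \<longlonglongrightarrow> M (n + 1 - a) (n + 1 - a) + (- 1) ^ r * M a (n + 1 - a)"
proof -
  let ?b = "n + 1 - a" and ?U = "transition_matrix (path_graph n)"
  let ?f = "\<lambda>r u. complex_of_real (path_eigenvector n r u)"
  have b: "?b \<in> {1..n}" using a by auto
  have V: "pverts (path_graph n) = {1..n}" by (simp add: path_graph_def)
  have "M \<in> closure (range ?U)" using M by (simp add: revival_matrix_def transition_closure_def)
  then obtain x where x: "\<And>k. x k \<in> range ?U" "x \<longlonglongrightarrow> M"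
    unfolding closure_sequential by blast
  from x(1) have "\<forall>k. \<exists>t. x k = ?U t" by blast
  then have "\<exists>t. \<forall>k. x k = ?U (t k)" by (rule choice)
  then obtain t where t: "\<And>k. x k = ?U (t k)" by blast
  have lim: "(\<lambda>k. ?U (t k) u w) \<longlonglongrightarrow> M u w" for u w
    using x(2) unfolding t tendsto_fun_iff by blast
  have zero: "M u a = 0" "M u ?b = 0" if "u \<in> {1..n} - {a, ?b}" for u
    using M that by (auto simp: revival_matrix_def V)
  have key: "(\<lambda>k. cis (- t k * path_eigenvalue n r) * ?f r w) \<longlonglongrightarrow> ?f r a * M a w + ?f r ?b * M ?b w"
    if r: "r < n" and w: "w = a \<or> w = ?b" for r w
  proof -
    have "w \<in> {1..n}" using w a b by auto
    have "(\<lambda>k. \<Sum>u\<in>{1..n}. ?f r u * ?U (t k) u w) \<longlonglongrightarrow> (\<Sum>u\<in>{1..n}. ?f r u * M u w)"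
      by (intro tendsto_sum tendsto_mult tendsto_const lim)
    also have "(\<Sum>u\<in>{1..n}. ?f r u * M u w) = (\<Sum>u\<in>{a, ?b}. ?f r u * M u w)"
      using a b w zero by (intro sum.mono_neutral_right) auto
    finally show ?thesis
      unfolding transition_matrix_left_eigenvector[OF n r \<open>w \<in> {1..n}\<close>] using ab by simp
  qed
  have sgn: "?f r ?b = (- 1) ^ r * ?f r a" for r
    unfolding path_eigenvector_reflect[OF n a] by simp
  have one: "(- 1) ^ r * ((- 1) ^ r * z) = z" for r and z :: complex
    by (simp add: minus_one_power_iff)
  show ?thesis
  proof
    fix r assume r: "r < n" "path_eigenvector n r a \<noteq> 0"
    have "(\<lambda>k. cis (- t k * path_eigenvalue n r) * ?f r a / ?f r a)
        \<longlonglongrightarrow> (?f r a * M a a + ?f r ?b * M ?b a) / ?f r a"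
      using r by (intro tendsto_divide key tendsto_const) auto
    then show "(\<lambda>k. cis (- t k * path_eigenvalue n r)) \<longlonglongrightarrow> M a a + (- 1) ^ r * M ?b a"
      using r(2) unfolding sgn by (simp add: add_divide_distrib)
    have fb: "?f r ?b \<noteq> 0" using r(2) unfolding sgn by simp
    have "(\<lambda>k. cis (- t k * path_eigenvalue n r) * ?f r ?b / ?f r ?b)
        \<longlonglongrightarrow> (?f r a * M a ?b + ?f r ?b * M ?b ?b) / ?f r ?b"
      using r fb by (intro tendsto_divide key tendsto_const) auto
    moreover have "(?f r a * M a ?b + ?f r ?b * M ?b ?b) / ?f r ?b = M ?b ?b + (- 1) ^ r * M a ?b"
      using r(2) one[of r "M a ?b"] unfolding sgn by (auto simp: minus_one_power_iff field_simps)
    ultimately show "(\<lambda>k. cis (- t k * path_eigenvalue n r)) \<longlonglongrightarrow> M ?b ?b + (- 1) ^ r * M a ?b"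
      using fb by simp
  qed
qed

text \<open>The approximated character is multiplicative in \<open>x\<close>, so integer relations
  between eigenvalues become multiplicative relations between limits.\<close>

definition phase_limit :: "(nat \<Rightarrow> real) \<Rightarrow> real \<Rightarrow> complex \<Rightarrow> bool" where
  "phase_limit t x z \<longleftrightarrow> (\<lambda>k. cis (- t k * x)) \<longlonglongrightarrow> z"

lemma phase_limit_unique: "phase_limit t x z \<Longrightarrow> phase_limit t x w \<Longrightarrow> z = w"
  unfolding phase_limit_def by (rule LIMSEQ_unique)

lemma phase_limit_sum:
  assumes "\<And>i. i \<in> I \<Longrightarrow> phase_limit t (x i) (z i)"
  shows "phase_limit t (\<Sum>i\<in>I. x i) (\<Prod>i\<in>I. z i)"
proof -
  have "(\<lambda>k. \<Prod>i\<in>I. cis (- t k * x i)) \<longlonglongrightarrow> (\<Prod>i\<in>I. z i)"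
    using assms unfolding phase_limit_def by (intro tendsto_prod)
  moreover have "(\<Prod>i\<in>I. cis (- t k * x i)) = cis (- t k * (\<Sum>i\<in>I. x i))" for k
    by (induction I rule: infinite_finite_induct) (auto simp: cis_mult algebra_simps)
  ultimately show ?thesis unfolding phase_limit_def by simp
qed

lemma phase_limit_add: "phase_limit t x z \<Longrightarrow> phase_limit t y w \<Longrightarrow> phase_limit t (x + y) (z * w)"
  unfolding phase_limit_def distrib_left cis_mult[symmetric] by (rule tendsto_mult)

lemma phase_limit_mult: "phase_limit t x z \<Longrightarrow> phase_limit t (real m * x) (z ^ m)"
  using phase_limit_sum[of "{..<m}" t "\<lambda>_. x" "\<lambda>_. z"] by simp

text \<open>The configuration that revival produces. The aim is \<open>\<zeta> = 1\<close> outside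
  the exceptional cases.\<close>

context
  fixes n a :: nat and t :: "nat \<Rightarrow> real" and \<zeta> :: complex
  assumes n: "n \<ge> 2" and a: "a \<in> {1..n}"
    and phases: "\<And>r. r < n \<Longrightarrow> path_eigenvector n r a \<noteq> 0 \<Longrightarrow>
      phase_limit t (path_eigenvalue n r) (if even r then 1 else \<zeta>)"
begin

text \<open>The index \<open>n\<close> is excluded because folding fixes it and no phase is
  prescribed there.\<close>

lemma phase_limit_fold:
  assumes s: "s < 2 * n" "s \<noteq> n" and supp: "path_eigenvector n s a \<noteq> 0"
  shows "phase_limit t (path_eigenvalue n s) (if even s then 1 else \<zeta>)"
proof (cases "s < n")
  case True
  then show ?thesis using phases supp by blast
next
  case False
  have "path_eigenvector n (2 * n - s) a \<noteq> 0"
    using path_eigenvector_fold[of n a s] n a s supp by auto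
  then have "phase_limit t (path_eigenvalue n (2 * n - s)) (if even (2 * n - s) then 1 else \<zeta>)"
    using False s by (intro phases) auto
  then show ?thesis using path_eigenvalue_fold[of n s] n s by simp
qed

text \<open>All \<open>q\<close> translates have the parity of \<open>s\<close> and their
  eigenvalues add up to \<open>2 q\<close>. The bound on \<open>s\<close> keeps them below
  \<open>2 n\<close>.\<close>

lemma phase_limit_translates:
  assumes q: "q dvd n" "q \<ge> 2" and s: "s < 2 * (n div q)"
    and supp: "\<And>j. j < q \<Longrightarrow> s + 2 * j * (n div q) \<noteq> n \<and> path_eigenvector n (s + 2 * j * (n div q)) a \<noteq> 0"
  shows "phase_limit t (2 * real q) ((if even s then 1 else \<zeta>) ^ q)"
proof -
  have "phase_limit t (path_eigenvalue n (s + 2 * j * (n div q))) (if even s then 1 else \<zeta>)" if "j < q" for j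
  proof -
    have "s + 2 * j * (n div q) < 2 * (j + 1) * (n div q)" using s by (simp add: algebra_simps)
    also have "\<dots> \<le> 2 * q * (n div q)" using that by (intro mult_le_mono1) simp
    also have "\<dots> = 2 * n" using q by simp
    finally show ?thesis using phase_limit_fold[of "s + 2 * j * (n div q)"] supp[OF that] by simp
  qed
  then have "phase_limit t (\<Sum>j<q. path_eigenvalue n (s + 2 * j * (n div q))) (\<Prod>j<q. if even s then 1 else \<zeta>)"
    by (intro phase_limit_sum) simp
  then show ?thesis using path_eigenvalue_translates[of n q s] q n by simp
qed

lemma phase_limit_pair:
  assumes "1 \<le> s" "s < n" "path_eigenvector n s a \<noteq> 0" "path_eigenvector n (n - s) a \<noteq> 0"
  shows "phase_limit t 4 ((if even s then 1 else \<zeta>) * (if even (n - s) then 1 else \<zeta>))"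
  using phase_limit_add[OF phases[of s] phases[of "n - s"]] path_eigenvalue_pair[of n s] assms by simp

text \<open>For odd \<open>n\<close>, all even indices are in the support. Translates of 0 give the
  limit 1 at \<open>4 q\<close>, and the pair 1, \<open>n - 1\<close> gives \<open>\<zeta>\<close>
  at 4; hence \<open>\<zeta> ^ q = 1\<close> for each of two distinct primes.\<close>

lemma phase_odd_order:
  assumes "odd n" and ab: "2 * a \<noteq> n + 1" and p: "prime p" "prime q" "p \<noteq> q" "p dvd n" "q dvd n"
  shows "\<zeta> = 1"
proof -
  have even_supp: "path_eigenvector n r a \<noteq> 0" if "even r" for r
    using that assms(1) n a by (subst path_eigenvector_eq_0_iff) (auto, metis even_mult_iff)
  have pow: "\<zeta> ^ q = 1" if "prime q" "q dvd n" for q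
  proof -
    have q2: "q \<ge> 2" using that prime_ge_2_nat by blast
    have "0 < n div q" using that n by (auto simp: div_greater_zero_iff dvd_imp_le prime_gt_0_nat)
    moreover have ev: "even (0 + 2 * j * (n div q))" for j by simp
    moreover have "0 + 2 * j * (n div q) \<noteq> n" for j using ev[of j] \<open>odd n\<close> by metis
    ultimately have "phase_limit t (2 * real q) 1"
      using phase_limit_translates[OF that(2) q2, of 0] even_supp[OF ev] by simp
    from phase_limit_mult[OF this, of 2] have 1: "phase_limit t (4 * real q) 1" by simp
    \<comment> \<open>A zero would make \<open>2 * a - 1\<close> an odd multiple of \<open>n\<close>
      below \<open>2 * n\<close>, so \<open>a\<close> would be the middle vertex.\<close>
    have "path_eigenvector n 1 a \<noteq> 0"
    proof
      assume "path_eigenvector n 1 a = 0"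
      then obtain i where i: "odd i" "2 * a - 1 = i * n"
        using path_eigenvector_eq_0_iff[of n a 1] n a by auto
      moreover have "i < 2"
      proof (rule ccontr)
        assume "\<not> i < 2"
        then have "2 * n \<le> i * n" by simp
        then have "2 * n \<le> 2 * a - 1" unfolding i(2) .
        moreover have "1 \<le> a" "a \<le> n" using a by auto
        ultimately show False by linarith
      qed
      ultimately have "i = 1" by (cases i) auto
      then show False using i a ab by auto
    qed
    then have "phase_limit t 4 \<zeta>"
      using phase_limit_pair[of 1] even_supp[of "n - 1"] n \<open>odd n\<close> by simp
    from phase_limit_mult[OF this, of q] have "phase_limit t (4 * real q) (\<zeta> ^ q)" by (simp add: mult.commute)
    from phase_limit_unique[OF this 1] show ?thesis .
  qed
  show ?thesis
    by (rule eq_1_if_coprime_powers[of _ p q]) (use p pow in \<open>auto simp: primes_coprime prime_gt_0_nat\<close>)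
qed

lemma path_eigenvector_odd_nonzero: "even n \<Longrightarrow> odd r \<Longrightarrow> path_eigenvector n r a \<noteq> 0"
proof
  assume "even n" "odd r" "path_eigenvector n r a = 0"
  then obtain i where "r * (2 * a - 1) = i * n"
    using path_eigenvector_eq_0_iff[of n a r] n a by auto
  moreover have "odd (r * (2 * a - 1))" using \<open>odd r\<close> a by simp
  ultimately show False using \<open>even n\<close> by simp
qed

text \<open>The index \<open>n div 2\<close> has eigenvalue 2 and is always in the support, since a
  zero would make \<open>2 * a - 1\<close> even.\<close>

lemma phase_limit_half:
  assumes "even n"
  shows "phase_limit t 2 (if even (n div 2) then 1 else \<zeta>)"
proof -
  have "path_eigenvector n (n div 2) a \<noteq> 0"
  proof
    assume "path_eigenvector n (n div 2) a = 0"
    then obtain i where i: "odd i" "n div 2 * (2 * a - 1) = i * n"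
      using path_eigenvector_eq_0_iff[of n a] n a by auto
    then have "n div 2 * (2 * a - 1) = n div 2 * (2 * i)" using assms by auto
    then have "2 * a - 1 = 2 * i" using assms n by auto
    moreover have "a \<ge> 1" using a by simp
    ultimately show False by presburger
  qed
  then show ?thesis using phases[of "n div 2"] path_eigenvalue_half[of n] assms n by simp
qed

text \<open>Here \<open>n div 2\<close> is even, so the limit at 2 is 1. Translates of 1 then give
  \<open>\<zeta> ^ q = 1\<close>, and the odd pair 1, \<open>n - 1\<close> gives
  \<open>\<zeta> ^ 2 = 1\<close>.\<close>

lemma phase_order_div_4:
  assumes "4 dvd n" and q: "prime q" "odd q" "q dvd n"
  shows "\<zeta> = 1"
proof -
  have "even n" using assms(1) by presburger
  have "even (n div 2)" using assms(1) by (auto elim!: dvdE)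
  then have lim2: "phase_limit t 2 1" using phase_limit_half[OF \<open>even n\<close>] by simp
  have q2: "q \<ge> 2" using q prime_ge_2_nat by blast
  have "0 < n div q" using q n by (auto simp: div_greater_zero_iff dvd_imp_le prime_gt_0_nat)
  then have "1 < 2 * (n div q)" by simp
  moreover have "odd (1 + 2 * j * (n div q))" for j by simp
  then have "1 + 2 * j * (n div q) \<noteq> n" for j using \<open>even n\<close> by metis
  ultimately have "phase_limit t (2 * real q) (\<zeta> ^ q)"
    using phase_limit_translates[OF q(3) q2, of 1] path_eigenvector_odd_nonzero[OF \<open>even n\<close>] by simp
  moreover have "phase_limit t (2 * real q) 1" using phase_limit_mult[OF lim2, of q] by (simp add: mult.commute)
  ultimately have zq: "\<zeta> ^ q = 1" by (rule phase_limit_unique)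
  have "phase_limit t 4 (\<zeta> * \<zeta>)"
    using phase_limit_pair[of 1] path_eigenvector_odd_nonzero[OF \<open>even n\<close>] n \<open>even n\<close> by simp
  moreover have "phase_limit t 4 1" using phase_limit_mult[OF lim2, of 2] by simp
  ultimately have "\<zeta> * \<zeta> = 1" by (rule phase_limit_unique)
  then have "\<zeta> ^ 2 = 1" by (simp add: power2_eq_square)
  then show ?thesis using eq_1_if_coprime_powers[of \<zeta> 2 q] zq q by simp
qed

context
  fixes m :: nat
  assumes nm: "n = 2 * m" and m: "odd m"
begin

text \<open>Now \<open>n div 2\<close> is odd, so the limit at 2 is \<open>\<zeta>\<close>. The
  translates of 0 are multiples of 4, hence in the support, and give the limit 1 at
  \<open>2 q\<close>.\<close>

lemma phase_pow_twice_odd: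
  assumes q: "prime q" "q dvd m"
  shows "\<zeta> ^ q = 1"
proof -
  have q2: "q \<ge> 2" and qn: "q dvd n" using q nm prime_ge_2_nat by auto
  have d: "n div q = 2 * (m div q)" using q nm by (simp add: div_mult_swap)
  have "0 < n div q" using q qn n by (auto simp: div_greater_zero_iff dvd_imp_le prime_gt_0_nat)
  moreover have "0 + 2 * j * (n div q) \<noteq> n" for j
  proof
    assume "0 + 2 * j * (n div q) = n"
    then have "m = 2 * (j * (m div q))" unfolding d by (simp add: nm)
    then show False using m by (metis dvd_triv_left)
  qed
  moreover have "path_eigenvector n (0 + 2 * j * (n div q)) a \<noteq> 0" for j
  proof
    assume "path_eigenvector n (0 + 2 * j * (n div q)) a = 0"
    then obtain i where i: "odd i" "(0 + 2 * j * (n div q)) * (2 * a - 1) = i * n"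
      using path_eigenvector_eq_0_iff[of n a] n a by auto
    then have "2 * (2 * (j * (m div q) * (2 * a - 1))) = 2 * (i * m)" unfolding d by (simp add: nm mult_ac)
    then have "i * m = 2 * (j * (m div q) * (2 * a - 1))" by simp
    then have "even (i * m)" by (metis dvd_triv_left)
    then show False using i m by simp
  qed
  ultimately have "phase_limit t (2 * real q) 1"
    using phase_limit_translates[OF qn q2, of 0] by simp
  moreover have "phase_limit t (real q * 2) (\<zeta> ^ q)"
    using phase_limit_mult[OF phase_limit_half, of q] nm m by simp
  ultimately show ?thesis using phase_limit_unique by (simp add: mult.commute)
qed

text \<open>Index 2 is in the support because \<open>m\<close> does not divide
  \<open>2 * a - 1\<close>, and \<open>n - 2\<close> because it is a multiple of 4. This even pair
  gives 1 at 4, where the middle index gives \<open>\<zeta> ^ 2\<close>.\<close>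

lemma phase_twice_odd_not_dvd:
  assumes m3: "m \<ge> 2" and dvd: "\<not> m dvd 2 * a - 1"
  shows "\<zeta> = 1"
proof -
  obtain q where q: "prime q" "q dvd m" using prime_factor_nat[of m] m3 by auto
  have "path_eigenvector n 2 a \<noteq> 0"
  proof
    assume "path_eigenvector n 2 a = 0"
    then obtain i where i: "odd i" "2 * (2 * a - 1) = i * n"
      using path_eigenvector_eq_0_iff[of n a] n a by auto
    then have "2 * (2 * a - 1) = 2 * (i * m)" unfolding nm by simp
    then show False using dvd by simp
  qed
  moreover have "path_eigenvector n (n - 2) a \<noteq> 0"
  proof
    assume "path_eigenvector n (n - 2) a = 0"
    then obtain i where i: "odd i" "(n - 2) * (2 * a - 1) = i * n"
      using path_eigenvector_eq_0_iff[of n a] n a by auto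
    moreover have "n - 2 = 2 * (m - 1)" unfolding nm by simp
    ultimately have "2 * ((m - 1) * (2 * a - 1)) = 2 * (i * m)" by (simp add: nm)
    then have "(m - 1) * (2 * a - 1) = i * m" by simp
    then have "even (i * m)" using m by (metis even_mult_iff odd_even_add even_diff_nat odd_one)
    then show False using i m by simp
  qed
  ultimately have "phase_limit t 4 1"
    using phase_limit_pair[of 2] m3 nm by simp
  moreover have "phase_limit t 4 (\<zeta> ^ 2)"
    using phase_limit_mult[OF phase_limit_half, of 2] nm m by simp
  ultimately have "\<zeta> ^ 2 = 1" using phase_limit_unique by blast
  moreover have "odd q" using q m by auto
  ultimately show ?thesis using eq_1_if_coprime_powers[of \<zeta> 2 q] phase_pow_twice_odd[OF q] q by simp
qed

lemma phase_twice_odd_two_primes: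
  assumes "prime p" "prime q" "p \<noteq> q" "p dvd m" "q dvd m"
  shows "\<zeta> = 1"
  by (rule eq_1_if_coprime_powers[of _ p q])
    (use assms phase_pow_twice_odd in \<open>auto simp: primes_coprime prime_gt_0_nat\<close>)

end

text \<open>A case split on \<open>n\<close> modulo 4. The second exception is phrased by
  divisibility; for \<open>a \<le> n\<close> it amounts to two values of \<open>a\<close>.\<close>

lemma phase_eq_1:
  assumes ab: "2 * a \<noteq> n + 1"
    and pp: "\<not> (\<exists>p l. prime p \<and> l \<ge> 1 \<and> n = p ^ l)"
    and tpp: "\<not> (\<exists>p l. prime p \<and> odd p \<and> l \<ge> 1 \<and> n = 2 * p ^ l \<and> p ^ l dvd 2 * a - 1)"
  shows "\<zeta> = 1"
proof -
  obtain p q where pq: "prime p" "prime q" "p \<noteq> q" "p dvd n" "q dvd n"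
    by (rule not_prime_power_two_primes[OF n pp])
  consider "odd n" | "4 dvd n" | "even n" "\<not> 4 dvd n" by blast
  then show ?thesis
  proof cases
    case 1
    then show ?thesis using phase_odd_order ab pq by blast
  next
    case 2
    have "odd p \<or> odd q" using pq primes_dvd_imp_eq two_is_prime_nat by blast
    then show ?thesis using phase_order_div_4[OF 2] pq by blast
  next
    case 3
    then obtain m where nm: "n = 2 * m" by (auto elim: evenE)
    have m: "odd m" using 3 unfolding nm by (auto elim: evenE)
    \<comment> \<open>The value \<open>m = 1\<close> would make \<open>n\<close> the prime
      2.\<close>
    have m2: "m \<ge> 2" proof (rule ccontr)
      assume "\<not> m \<ge> 2"
      then have "n = 2 ^ 1" using m nm by (cases m) auto
      then show False using pp two_is_prime_nat by blast
    qed
    show ?thesis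
    proof (cases "\<exists>p l. prime p \<and> l \<ge> 1 \<and> m = p ^ l")
      case True
      then obtain p l where pl: "prime p" "l \<ge> 1" "m = p ^ l" by blast
      then have "odd p" using m by auto
      then have "\<not> m dvd 2 * a - 1" using tpp pl nm by blast
      then show ?thesis by (rule phase_twice_odd_not_dvd[OF nm m m2])
    next
      case False
      then obtain p q where "prime p" "prime q" "p \<noteq> q" "p dvd m" "q dvd m"
        by (rule not_prime_power_two_primes[OF m2])
      then show ?thesis by (rule phase_twice_odd_two_primes[OF nm m])
    qed
  qed
qed

end

text \<open>Each of the two columns has its own \<open>\<zeta>\<close>, the difference of its
  diagonal and off-diagonal entry. Index 0 makes their sum 1, so \<open>\<zeta> = 1\<close> in both
  columns kills both off-diagonal entries.\<close>

lemma proper_PGFR_path_necessary: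
  assumes n: "n \<ge> 2" and a: "a \<in> {1..n}"
    and P: "proper_laplacian_PGFR (path_graph n) a (n + 1 - a)"
  shows "2 * a \<noteq> n + 1 \<and> ((\<exists>p l. prime p \<and> l \<ge> 1 \<and> n = p ^ l) \<or>
    (\<exists>p l. prime p \<and> odd p \<and> l \<ge> 1 \<and> n = 2 * p ^ l \<and> p ^ l dvd 2 * a - 1))"
proof -
  let ?b = "n + 1 - a"
  obtain M where ab: "a \<noteq> ?b" and M: "revival_matrix (path_graph n) a ?b M"
    and nd: "\<not> is_diagonal (mat_block {a, ?b} M)"
    using P by (auto simp: proper_laplacian_PGFR_def laplacian_PGFR_def)
  have n1: "n \<ge> 1" using n by simp
  obtain t where t:
    "\<And>r. r < n \<Longrightarrow> path_eigenvector n r a \<noteq> 0 \<Longrightarrow>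
      phase_limit t (path_eigenvalue n r) (M a a + (- 1) ^ r * M ?b a)"
    "\<And>r. r < n \<Longrightarrow> path_eigenvector n r a \<noteq> 0 \<Longrightarrow>
      phase_limit t (path_eigenvalue n r) (M ?b ?b + (- 1) ^ r * M a ?b)"
    using revival_phases[OF n1 a ab M] unfolding phase_limit_def by metis
  have f0: "path_eigenvector n 0 a \<noteq> 0" by (simp add: path_eigenvector_def)
  have "phase_limit t (path_eigenvalue n 0) 1" by (simp add: phase_limit_def path_eigenvalue_def)
  then have one: "M a a + M ?b a = 1" "M ?b ?b + M a ?b = 1"
    using phase_limit_unique t[of 0] f0 n by fastforce+
  show ?thesis
  proof (rule ccontr)
    assume neg: "\<not> ?thesis"
    have ab': "2 * a \<noteq> n + 1" using ab by auto
    have eq1: "\<zeta> = 1" if "\<And>r. r < n \<Longrightarrow> path_eigenvector n r a \<noteq> 0 \<Longrightarrow>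
      phase_limit t (path_eigenvalue n r) (if even r then 1 else \<zeta>)" for \<zeta>
      by (rule phase_eq_1[OF n a that]) (use ab' neg in auto)
    have "M a a - M ?b a = 1"
    proof (rule eq1)
      fix r assume "r < n" "path_eigenvector n r a \<noteq> 0"
      from t(1)[OF this] show "phase_limit t (path_eigenvalue n r) (if even r then 1 else M a a - M ?b a)"
        using one by (cases "even r") simp_all
    qed
    moreover have "M ?b ?b - M a ?b = 1"
    proof (rule eq1)
      fix r assume "r < n" "path_eigenvector n r a \<noteq> 0"
      from t(2)[OF this] show "phase_limit t (path_eigenvalue n r) (if even r then 1 else M ?b ?b - M a ?b)"
        using one by (cases "even r") simp_all
    qed
    ultimately have "2 * M ?b a = 0" "2 * M a ?b = 0" using one by (simp_all add: algebra_simps)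
    then have "M ?b a = 0" "M a ?b = 0" by simp_all
    then have "is_diagonal (mat_block {a, ?b} M)"
      by (auto simp: is_diagonal_def mat_block_def)
    then show False using nd by blast
  qed
qed

subsection \<open>Sufficiency\<close>

text \<open>Kronecker's theorem yields times whose transition matrices converge to the spectral sum
  with phases \<open>2 \<pi> \<alpha> r\<close>. Off the support of \<open>a\<close> these phases do
  not affect rows \<open>a\<close> and \<open>n + 1 - a\<close>, so they are only bound by the
  relations.\<close>

lemma proper_PGFR_path_of_phases:
  assumes n: "n \<ge> 1" and a: "a \<in> {1..n}" and ab: "a \<noteq> n + 1 - a"
    and rel: "\<And>c::nat \<Rightarrow> int. (\<Sum>r<n. of_int (c r) * path_eigenvalue n r) = 0 \<Longrightarrow>
      (\<Sum>r<n. of_int (c r) * \<alpha> r) \<in> \<int>"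
    and phase: "\<And>r. r < n \<Longrightarrow> path_eigenvector n r a \<noteq> 0 \<Longrightarrow>
      cis (2 * pi * \<alpha> r) = (if even r then 1 else \<zeta>)"
    and \<zeta>: "cmod \<zeta> = 1" "\<zeta> \<noteq> 1"
  shows "proper_laplacian_PGFR (path_graph n) a (n + 1 - a)"
proof -
  let ?b = "n + 1 - a" and ?U = "transition_matrix (path_graph n)"
  let ?f = "\<lambda>r u. path_eigenvector n r u"
  have b: "?b \<in> {1..n}" using a by auto
  have V: "pverts (path_graph n) = {1..n}" by (simp add: path_graph_def)
  define M where "M u w = (if u \<in> {1..n} \<and> w \<in> {1..n} then
    \<Sum>r<n. cis (2 * pi * \<alpha> r) * of_real (path_weight n r * ?f r u * ?f r w) else 0)" for u w
  have "\<exists>t. \<forall>r<n. \<exists>h::int. \<bar>t * path_eigenvalue n r - of_int h - \<alpha> r\<bar> < inverse (real (Suc k))" for k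
  proof (rule Kronecker_with_relations[of "{..<n}" "path_eigenvalue n" \<alpha> "inverse (real (Suc k))"])
    fix t assume "\<And>r. r \<in> {..<n} \<Longrightarrow> \<exists>h::int. \<bar>t * path_eigenvalue n r - of_int h - \<alpha> r\<bar> < inverse (real (Suc k))"
    then show ?thesis by (intro exI[of _ t]) simp
  qed (use rel in simp_all)
  then have "\<forall>k. \<exists>t. \<forall>r<n. \<exists>h::int. \<bar>t * path_eigenvalue n r - of_int h - \<alpha> r\<bar> < inverse (real (Suc k))"
    by blast
  from choice[OF this] obtain t where
    t: "\<And>k. \<forall>r<n. \<exists>h::int. \<bar>t k * path_eigenvalue n r - of_int h - \<alpha> r\<bar> < inverse (real (Suc k))"
    by blast
  define h :: "nat \<Rightarrow> nat \<Rightarrow> int" where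
    "h k r = (SOME h. \<bar>t k * path_eigenvalue n r - of_int h - \<alpha> r\<bar> < inverse (real (Suc k)))" for k r
  have h: "\<bar>t k * path_eigenvalue n r - of_int (h k r) - \<alpha> r\<bar> < inverse (real (Suc k))" if "r < n" for k r
    unfolding h_def by (rule someI_ex[OF t[rule_format, OF that]])
  \<comment> \<open>Kronecker's theorem counts full turns, and the exponent of the transition matrix
    carries a minus sign.\<close>
  define \<tau> where "\<tau> k = - (2 * pi * t k)" for k
  have lim: "(\<lambda>k. cis (- \<tau> k * path_eigenvalue n r)) \<longlonglongrightarrow> cis (2 * pi * \<alpha> r)" if r: "r < n" for r
  proof -
    let ?x = "\<lambda>k. t k * path_eigenvalue n r - of_int (h k r)"
    have "(\<lambda>k. ?x k - \<alpha> r) \<longlonglongrightarrow> 0"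
      by (rule LIMSEQ_norm_0) (use h[OF r] in \<open>simp add: inverse_eq_divide\<close>)
    then have "?x \<longlonglongrightarrow> \<alpha> r" by (simp add: LIM_zero_iff)
    then have "(\<lambda>k. cis (2 * pi * ?x k)) \<longlonglongrightarrow> cis (2 * pi * \<alpha> r)"
      by (intro tendsto_intros)
    moreover have "cis (2 * pi * ?x k) = cis (- \<tau> k * path_eigenvalue n r)" for k
    proof -
      have "2 * pi * ?x k = - \<tau> k * path_eigenvalue n r - 2 * pi * of_int (h k r)"
        by (simp add: \<tau>_def algebra_simps)
      then show ?thesis by (simp add: cis_multiple_2pi flip: cis_divide)
    qed
    ultimately show ?thesis by simp
  qed
  have "(\<lambda>k. ?U (\<tau> k) u w) \<longlonglongrightarrow> M u w" for u w
  proof (cases "u \<in> {1..n} \<and> w \<in> {1..n}")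
    case True
    have "(\<lambda>k. \<Sum>r<n. cis (- \<tau> k * path_eigenvalue n r) * of_real (path_weight n r * ?f r u * ?f r w))
        \<longlonglongrightarrow> (\<Sum>r<n. cis (2 * pi * \<alpha> r) * of_real (path_weight n r * ?f r u * ?f r w))"
      by (intro tendsto_sum tendsto_mult tendsto_const lim) simp
    moreover have "?U (\<tau> k) u w
        = (\<Sum>r<n. cis (- \<tau> k * path_eigenvalue n r) * of_real (path_weight n r * ?f r u * ?f r w))" for k
      using True by (intro transition_matrix_path_graph n) auto
    ultimately show ?thesis using True by (simp only: M_def if_True simp_thms)
  next
    case False
    then have "?U (\<tau> k) u w = 0" for k
      unfolding transition_matrix_def using mat_exp_outside V by metis
    then show ?thesis using False by (auto simp: M_def)
  qed
  then have "(\<lambda>k. ?U (\<tau> k)) \<longlonglongrightarrow> M" by (simp add: tendsto_fun_iff)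
  then have clos: "M \<in> transition_closure (path_graph n)"
    unfolding transition_closure_def closure_sequential
    by (intro exI[of _ "\<lambda>k. ?U (\<tau> k)"]) simp
  \<comment> \<open>The block has entries \<open>x\<close> on and \<open>y\<close> off the diagonal:
    it acts by \<open>x + y = 1\<close> on symmetric and by \<open>x - y = \<zeta>\<close> on
    antisymmetric vectors.\<close>
  define x y where "x = (1 + \<zeta>) / 2" and "y = (1 - \<zeta>) / 2"
  have sgn: "?f r ?b = (- 1) ^ r * ?f r a" for r by (rule path_eigenvector_reflect[OF n a])
  have Ma: "M a w = x * of_bool (a = w) + y * of_bool (?b = w)"
    and Mb: "M ?b w = y * of_bool (a = w) + x * of_bool (?b = w)" if w: "w \<in> {1..n}" for w
  proof -
    have *: "(\<Sum>r<n. of_real (path_weight n r * ?f r u * ?f r w)) = complex_of_real (of_bool (u = w))"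
      if "u \<in> {1..n}" for u
      by (simp only: of_real_sum[symmetric] path_eigenvector_complete[OF n that w]) simp
    have c1: "cis (2 * pi * \<alpha> r) * of_real (?f r a) = x * of_real (?f r a) + y * of_real (?f r ?b)"
      and c2: "cis (2 * pi * \<alpha> r) * of_real (?f r ?b) = y * of_real (?f r a) + x * of_real (?f r ?b)"
      if "r < n" for r
      using phase[OF that] unfolding sgn x_def y_def
      by (cases "?f r a = 0"; cases "even r"; simp add: field_simps)+
    have e1: "cis (2 * pi * \<alpha> r) * of_real (path_weight n r * ?f r a * ?f r w)
        = x * of_real (path_weight n r * ?f r a * ?f r w) + y * of_real (path_weight n r * ?f r ?b * ?f r w)"
      and e2: "cis (2 * pi * \<alpha> r) * of_real (path_weight n r * ?f r ?b * ?f r w)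
        = y * of_real (path_weight n r * ?f r a * ?f r w) + x * of_real (path_weight n r * ?f r ?b * ?f r w)"
      if "r < n" for r
      using arg_cong[OF c1[OF that], of "\<lambda>z. of_real (path_weight n r * ?f r w) * z"]
        arg_cong[OF c2[OF that], of "\<lambda>z. of_real (path_weight n r * ?f r w) * z"]
      by (simp_all add: algebra_simps)
    have "M a w = (\<Sum>r<n. x * of_real (path_weight n r * ?f r a * ?f r w) + y * of_real (path_weight n r * ?f r ?b * ?f r w))"
      using a w e1 by (simp only: M_def if_True simp_thms) (intro sum.cong refl, simp only: lessThan_iff)
    then show "M a w = x * of_bool (a = w) + y * of_bool (?b = w)"
      using *[OF a] *[OF b] by (simp add: sum.distrib flip: sum_distrib_left)
    have "M ?b w = (\<Sum>r<n. y * of_real (path_weight n r * ?f r a * ?f r w) + x * of_real (path_weight n r * ?f r ?b * ?f r w))"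
      using b w e2 by (simp only: M_def if_True simp_thms) (intro sum.cong refl, simp only: lessThan_iff)
    then show "M ?b w = y * of_bool (a = w) + x * of_bool (?b = w)"
      using *[OF a] *[OF b] by (simp add: sum.distrib flip: sum_distrib_left)
  qed
  have sym: "M u w = M w u" for u w
    by (auto simp: M_def mult_ac intro!: sum.cong)
  have M4: "M a a = x" "M a ?b = y" "M ?b a = y" "M ?b ?b = x"
    using Ma[OF a] Ma[OF b] Mb[OF a] Mb[OF b] ab by auto
  have zz: "\<zeta> * cnj \<zeta> = 1" using complex_norm_square[of \<zeta>] \<zeta>(1) by simp
  have xy: "x * cnj x + y * cnj y = 1" "x * cnj y + y * cnj x = 0"
    "cnj x * x + cnj y * y = 1" "cnj x * y + cnj y * x = 0" "cnj y * x + cnj x * y = 0"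
    "y * cnj x + x * cnj y = 0" "y * cnj y + x * cnj x = 1" "cnj y * y + cnj x * x = 1"
    unfolding x_def y_def using zz by (simp_all add: field_simps)
  have "unitary_on {a, ?b} (mat_block {a, ?b} M)"
    unfolding unitary_on_def mat_prod_def mat_adj_def mat_id_def mat_block_def
    using ab M4 xy by (auto simp: fun_eq_iff)
  moreover have "M u w = 0 \<and> M w u = 0" if "u \<in> {a, ?b}" "w \<in> {1..n} - {a, ?b}" for u w
    using that Ma[of w] Mb[of w] sym[of w u] by auto
  ultimately have rev: "revival_matrix (path_graph n) a ?b M"
    unfolding revival_matrix_def V using clos by blast
  have "y \<noteq> 0" using \<zeta>(2) by (simp add: y_def)
  then have "\<not> is_diagonal (mat_block {a, ?b} M)"
    unfolding is_diagonal_def mat_block_def using ab M4 by auto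
  then show ?thesis
    unfolding proper_laplacian_PGFR_def laplacian_PGFR_def V using a b ab rev by blast
qed

section \<open>Integer relations reduced modulo a prime\<close>

text \<open>Each eigenvalue is the integer combination
  \<open>2 - \<zeta> ^ r - \<zeta> ^ (2 * n - r)\<close> of powers of a \<open>2 n\<close>-th root
  of unity, so the Frobenius congruence multiplies every index by \<open>p ^ k\<close>.\<close>

lemma path_relation_prime_power:
  fixes c :: "nat \<Rightarrow> int"
  assumes n: "n \<ge> 1" and p: "prime (p::nat)"
    and rel: "(\<Sum>r<n. of_int (c r) * path_eigenvalue n r) = 0"
    and m: "(\<Sum>r<n. of_int (c r) * path_eigenvalue n (r * p ^ k)) = of_int m"
  shows "int p dvd m"
proof -
  define \<zeta> where "\<zeta> = cis (pi / real n)"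
  have z: "\<zeta> ^ (2 * n) = 1" using n by (simp add: \<zeta>_def Complex.DeMoivre)
  \<comment> \<open>Three monomials for each \<open>r\<close>; the exponent \<open>2 * n - r\<close>
    stands for \<open>- r\<close>.\<close>
  define I where "I = {..<n} \<times> {0..<3::nat}"
  define d where "d = (\<lambda>(r, i). if i = (0::nat) then 2 * c r else - c r)"
  define e where "e = (\<lambda>(r, i). if i = (0::nat) then 0 else if i = 1 then r else 2 * n - r)"
  have key: "(\<Sum>x\<in>I. of_int (d x) * \<zeta> ^ (e x * j)) = of_real (\<Sum>r<n. of_int (c r) * path_eigenvalue n (r * j))" for j
  proof -
    have th: "of_real (path_eigenvalue n (r * j)) = 2 - \<zeta> ^ (r * j) - \<zeta> ^ ((2 * n - r) * j)" if "r < n" for r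
    proof -
      have "\<zeta> ^ (r * j) * \<zeta> ^ ((2 * n - r) * j) = (\<zeta> ^ (2 * n)) ^ j"
        using that by (simp flip: power_add power_mult add_mult_distrib)
      also have "\<dots> = 1" unfolding z by simp
      finally have "\<zeta> ^ ((2 * n - r) * j) = inverse (\<zeta> ^ (r * j))"
        by (rule inverse_unique[symmetric])
      also have "\<dots> = cnj (\<zeta> ^ (r * j))"
        by (simp add: \<zeta>_def Complex.DeMoivre cis_cnj)
      finally show ?thesis
        by (simp add: path_eigenvalue_def \<zeta>_def Complex.DeMoivre complex_eq_iff mult_ac)
    qed
    have "(\<Sum>x\<in>I. of_int (d x) * \<zeta> ^ (e x * j)) = (\<Sum>r<n. \<Sum>i\<in>{0..<3}. of_int (d (r, i)) * \<zeta> ^ (e (r, i) * j))"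
      unfolding I_def by (simp add: sum.cartesian_product)
    also have "\<dots> = (\<Sum>r<n. of_int (c r) * of_real (path_eigenvalue n (r * j)))"
      by (intro sum.cong refl) (simp add: th d_def e_def eval_nat_numeral algebra_simps)
    finally show ?thesis by simp
  qed
  show ?thesis
  proof (rule root_of_unity_relation_frobenius[OF z _ p])
    show "finite I" by (simp add: I_def)
    show "(\<Sum>x\<in>I. of_int (d x) * \<zeta> ^ e x) = 0"
      using key[of 1] rel by simp
    show "(\<Sum>x\<in>I. of_int (d x) * \<zeta> ^ (e x * p ^ k)) = of_int m"
      unfolding key m by simp
  qed (use n in simp)
qed

text \<open>
  For \<open>p = 2\<close> the reduction modulo \<open>2\<close> of the relation itself is void, because \<open>\<theta>\<^sub>r\<close> is divisible by
  \<open>(1 - \<zeta>)\<^sup>2\<close>.  It has to be applied to the quotients \<open>\<theta>\<^sub>r / (1 - \<zeta>)\<^sup>2 = - \<zeta>\<^bsup>2n - r\<^esup> (1 + \<zeta> + \<dots> + \<zeta>\<^bsup>r - 1\<^esup>)\<^sup>2\<close>.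
\<close>

lemma path_relation_power_of_2:
  fixes c :: "nat \<Rightarrow> int"
  assumes n: "n = 2 ^ l" and rel: "(\<Sum>r<n. of_int (c r) * path_eigenvalue n r) = 0"
  shows "even (\<Sum>r<n. c r * int r ^ 2)"
proof -
  have n1: "n \<ge> 1" using n by simp
  define \<zeta> where "\<zeta> = cis (pi / real n)"
  have z: "\<zeta> ^ (2 * n) = 1" using n1 by (simp add: \<zeta>_def Complex.DeMoivre)
  have z1: "\<zeta> \<noteq> 1"
  proof
    assume "\<zeta> = 1"
    then have "\<zeta> ^ n = 1" by simp
    moreover have "\<zeta> ^ n = - 1" using n1 by (simp add: \<zeta>_def Complex.DeMoivre)
    ultimately show False by simp
  qed
  \<comment> \<open>The triples \<open>(r, i, j)\<close> index the expanded squares of the geometric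
    sums.\<close>
  define I where "I = Sigma {..<n} (\<lambda>r. {..<r} \<times> {..<r})"
  define e where "e = (\<lambda>(r, i, j). 2 * n - r + i + j)"
  have sum: "(\<Sum>x\<in>I. of_int (c (fst x)) * \<zeta> ^ (e x * q))
      = (\<Sum>r<n. of_int (c r) * (\<zeta> ^ ((2 * n - r) * q) * (\<Sum>i<r. \<zeta> ^ (i * q)) ^ 2))" for q
  proof -
    have "(\<Sum>x\<in>I. of_int (c (fst x)) * \<zeta> ^ (e x * q))
        = (\<Sum>r<n. \<Sum>x\<in>{..<r} \<times> {..<r}. of_int (c r) * \<zeta> ^ (e (r, x) * q))"
      unfolding I_def by (subst sum.Sigma) (auto intro!: sum.cong)
    also have "\<dots> = (\<Sum>r<n. \<Sum>i<r. \<Sum>j<r. of_int (c r) * \<zeta> ^ (e (r, i, j) * q))"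
      by (simp add: sum.cartesian_product case_prod_beta)
    also have "\<dots> = (\<Sum>r<n. of_int (c r) * (\<zeta> ^ ((2 * n - r) * q) * (\<Sum>i<r. \<zeta> ^ (i * q)) ^ 2))"
    proof (intro sum.cong refl)
      fix r
      have e: "e (r, i, j) * q = (2 * n - r) * q + (i * q + j * q)" for i j
        by (simp add: e_def add_mult_distrib)
      show "(\<Sum>i<r. \<Sum>j<r. of_int (c r) * \<zeta> ^ (e (r, i, j) * q))
          = of_int (c r) * (\<zeta> ^ ((2 * n - r) * q) * (\<Sum>i<r. \<zeta> ^ (i * q)) ^ 2)"
        unfolding e power_add power2_eq_square sum_product by (simp add: sum_distrib_left mult_ac)
    qed
    finally show ?thesis .
  qed
  have th: "(1 - \<zeta>) ^ 2 * (\<zeta> ^ (2 * n - r) * (\<Sum>i<r. \<zeta> ^ i) ^ 2) = - of_real (path_eigenvalue n r)" if "r < n" for r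
  proof -
    have inv: "\<zeta> ^ r * \<zeta> ^ (2 * n - r) = 1"
      using that z by (simp flip: power_add)
    have "\<zeta> ^ (2 * n - r) = inverse (\<zeta> ^ r)" by (rule inverse_unique[OF inv, symmetric])
    also have "\<dots> = cnj (\<zeta> ^ r)" by (simp add: \<zeta>_def Complex.DeMoivre cis_cnj)
    finally have cnj: "\<zeta> ^ (2 * n - r) = cnj (\<zeta> ^ r)" .
    have "(1 - \<zeta>) * (\<Sum>i<r. \<zeta> ^ i) = 1 - \<zeta> ^ r"
      by (rule one_diff_power_eq[symmetric])
    then have "(1 - \<zeta>) ^ 2 * (\<zeta> ^ (2 * n - r) * (\<Sum>i<r. \<zeta> ^ i) ^ 2) = \<zeta> ^ (2 * n - r) * (1 - \<zeta> ^ r) ^ 2"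
      by (metis mult.left_commute power_mult_distrib)
    also have "\<dots> = \<zeta> ^ (2 * n - r) - 2 * (\<zeta> ^ r * \<zeta> ^ (2 * n - r)) + \<zeta> ^ r * (\<zeta> ^ r * \<zeta> ^ (2 * n - r))"
      by (simp add: power2_eq_square algebra_simps)
    also have "\<dots> = \<zeta> ^ (2 * n - r) + \<zeta> ^ r - 2" unfolding inv by simp
    also have "\<zeta> ^ (2 * n - r) + \<zeta> ^ r - 2 = - of_real (path_eigenvalue n r)"
      unfolding cnj by (simp add: path_eigenvalue_def \<zeta>_def Complex.DeMoivre complex_eq_iff mult_ac)
    finally show ?thesis .
  qed
  have zero: "(\<Sum>x\<in>I. of_int (c (fst x)) * \<zeta> ^ e x) = 0"
  proof -
    have "(1 - \<zeta>) ^ 2 * (\<Sum>x\<in>I. of_int (c (fst x)) * \<zeta> ^ e x)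
        = (\<Sum>r<n. of_int (c r) * ((1 - \<zeta>) ^ 2 * (\<zeta> ^ (2 * n - r) * (\<Sum>i<r. \<zeta> ^ i) ^ 2)))"
      using sum[of 1] by (simp add: sum_distrib_left mult_ac)
    also have "\<dots> = (\<Sum>r<n. of_int (c r) * - of_real (path_eigenvalue n r))"
      by (intro sum.cong refl) (simp add: th)
    also have "\<dots> = - of_real (\<Sum>r<n. of_int (c r) * path_eigenvalue n r)"
      by (simp add: sum_negf)
    finally show ?thesis using rel z1 by simp
  qed
  have "int 2 dvd (\<Sum>r<n. c r * int r ^ 2)"
  proof (rule root_of_unity_relation_frobenius[OF z _ two_is_prime_nat])
    show "finite I" by (simp add: I_def)
    \<comment> \<open>Since \<open>2 ^ Suc l = 2 * n\<close>, this power of Frobenius sends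
      \<open>\<zeta>\<close> to 1, and the square for \<open>r\<close> becomes
      \<open>r ^ 2\<close>.\<close>
    have one: "\<zeta> ^ (i * 2 ^ Suc l) = 1" for i
      using z unfolding n by (metis mult.commute power_Suc power_mult power_one)
    show "(\<Sum>x\<in>I. of_int (c (fst x)) * \<zeta> ^ (e x * 2 ^ Suc l)) = of_int (\<Sum>r<n. c r * int r ^ 2)"
      unfolding sum unfolding one by simp
  qed (use n1 zero in simp_all)
  then show ?thesis by simp
qed

section \<open>Construction of revival in the three families\<close>

text \<open>Any relation satisfies \<open>p dvd K * (\<Sum>r<n. c r * w r)\<close>, and
  \<open>K\<close> cancels, so \<open>\<alpha> r = w r / p\<close> respects all relations and
  \<open>\<zeta>\<close> is a primitive \<open>p\<close>-th root of unity. Off the support the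
  weights may be other integers.\<close>

lemma proper_PGFR_path_of_weights:
  assumes n: "n \<ge> 1" and a: "a \<in> {1..n}" and ab: "2 * a \<noteq> n + 1"
    and p: "prime (p::nat)" and K: "coprime K (int p)"
    and w: "\<And>r. r < n \<Longrightarrow> path_eigenvalue n (r * p ^ k) = of_int (K * w r)"
    and supp: "\<And>r. r < n \<Longrightarrow> path_eigenvector n r a \<noteq> 0 \<Longrightarrow> w r = of_bool (odd r)"
  shows "proper_laplacian_PGFR (path_graph n) a (n + 1 - a)"
proof (rule proper_PGFR_path_of_phases[OF n a])
  show "a \<noteq> n + 1 - a" using ab a by auto
  show "cmod (cis (2 * pi / real p)) = 1" by simp
  show "cis (2 * pi / real p) \<noteq> 1"
  proof
    assume "cis (2 * pi / real p) = 1"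
    then have "cos (2 * pi / real p) = 1" by (auto simp: complex_eq_iff)
    then obtain i :: int where "2 * pi / real p = of_int i * 2 * pi" by (auto simp: cos_one_2pi_int)
    then have "real_of_int (int p * i) = 1" using prime_gt_0_nat[OF p] by (simp add: field_simps)
    then have "int p * i = 1" by linarith
    then have "int p dvd 1" by (rule dvdI[OF sym])
    then show False using prime_gt_1_nat[OF p] by simp
  qed
  show "cis (2 * pi * (of_int (w r) / real p)) = (if even r then 1 else cis (2 * pi / real p))"
    if "r < n" "path_eigenvector n r a \<noteq> 0" for r
    using supp[OF that] by simp
  fix c :: "nat \<Rightarrow> int"
  assume "(\<Sum>r<n. of_int (c r) * path_eigenvalue n r) = 0"
  then have "int p dvd (\<Sum>r<n. c r * (K * w r))"
    by (rule path_relation_prime_power[OF n p, where k = k]) (simp add: w)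
  then have "int p dvd K * (\<Sum>r<n. c r * w r)" by (simp add: sum_distrib_left mult_ac)
  then have "int p dvd (\<Sum>r<n. c r * w r)"
    using K by (simp add: coprime_dvd_mult_right_iff coprime_commute)
  then obtain m where m: "(\<Sum>r<n. c r * w r) = int p * m" by (auto elim: dvdE)
  have "(\<Sum>r<n. of_int (c r) * (of_int (w r) / real p)) = of_int (\<Sum>r<n. c r * w r) / real p"
    by (simp add: sum_divide_distrib)
  also have "\<dots> = of_int m" unfolding m using prime_gt_0_nat[OF p] by simp
  finally show "(\<Sum>r<n. of_int (c r) * (of_int (w r) / real p)) \<in> \<int>" by simp
qed

text \<open>Multiplying the index by \<open>p ^ l = n\<close> turns the eigenvalue into
  \<open>2 - 2 cos (\<pi> r)\<close>, which is 0 or 4 by parity, so \<open>K = 4\<close>.\<close>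

lemma proper_PGFR_path_odd_prime_power:
  assumes p: "prime p" "odd p" and n: "n = p ^ l" and a: "a \<in> {1..n}" and ab: "2 * a \<noteq> n + 1"
  shows "proper_laplacian_PGFR (path_graph n) a (n + 1 - a)"
proof (rule proper_PGFR_path_of_weights[OF _ a ab p(1)])
  show "n \<ge> 1" using a by simp
  show "coprime 4 (int p)"
  proof -
    have "coprime 2 (int p)" using p by simp
    then have "coprime (2 * 2) (int p)" by (simp only: coprime_mult_left_iff)
    then show ?thesis by simp
  qed
  show "path_eigenvalue n (r * p ^ l) = of_int (4 * of_bool (odd r))" for r
  proof -
    have "pi * real (r * p ^ l) / real n = real r * pi" using prime_gt_0_nat[OF p(1)] by (simp add: n)
    then show ?thesis by (simp add: path_eigenvalue_def)
  qed
qed simp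

text \<open>The parity statement for relations admits the phases \<open>r ^ 2 / 2\<close>, which
  realize \<open>\<zeta> = -1\<close>.\<close>

lemma proper_PGFR_path_power_of_2:
  assumes n: "n = 2 ^ l" "l \<ge> 1" and a: "a \<in> {1..n}"
  shows "proper_laplacian_PGFR (path_graph n) a (n + 1 - a)"
proof (rule proper_PGFR_path_of_phases[OF _ a])
  have "even n" using n by simp
  then show "a \<noteq> n + 1 - a" by presburger
  show "n \<ge> 1" using n by simp
  show "cis (2 * pi * (real r ^ 2 / 2)) = (if even r then 1 else - 1)" for r
  proof -
    have "2 * pi * (real r ^ 2 / 2) = real (r ^ 2) * pi" by simp
    then have "cis (2 * pi * (real r ^ 2 / 2)) = cis pi ^ (r ^ 2)" by (simp only: Complex.DeMoivre)
    then show ?thesis by (simp add: minus_one_power_iff)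
  qed
  fix c :: "nat \<Rightarrow> int"
  assume "(\<Sum>r<n. of_int (c r) * path_eigenvalue n r) = 0"
  from path_relation_power_of_2[OF n(1) this]
  obtain m where m: "(\<Sum>r<n. c r * int r ^ 2) = 2 * m" by (auto elim: evenE)
  have "(\<Sum>r<n. of_int (c r) * (real r ^ 2 / 2)) = of_int (\<Sum>r<n. c r * int r ^ 2) / 2"
    by (simp add: sum_divide_distrib)
  also have "\<dots> = of_int m" unfolding m by simp
  finally show "(\<Sum>r<n. of_int (c r) * (real r ^ 2 / 2)) \<in> \<int>" by simp
qed simp_all

text \<open>Multiplying the index by \<open>p ^ l = n / 2\<close> gives
  \<open>2 - 2 cos (\<pi> r / 2)\<close>, so \<open>K = 2\<close> with weights 1, 0 and 2. The
  unwanted weight 2 occurs for \<open>r\<close> congruent to 2 modulo 4, where the divisibility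
  condition makes the eigenvector vanish at \<open>a\<close>.\<close>

lemma proper_PGFR_path_twice_odd_prime_power:
  assumes p: "prime p" "odd p" and n: "n = 2 * p ^ l" and a: "a \<in> {1..n}"
    and dvd: "p ^ l dvd 2 * a - 1"
  shows "proper_laplacian_PGFR (path_graph n) a (n + 1 - a)"
proof (rule proper_PGFR_path_of_weights[OF _ a _ p(1)])
  show n1: "n \<ge> 1" using a by simp
  show "2 * a \<noteq> n + 1" unfolding n by presburger
  show "coprime 2 (int p)" using p by simp
  let ?w = "\<lambda>r::nat. if odd r then 1 else if 4 dvd r then 0 else 2 :: int"
  show "path_eigenvalue n (r * p ^ l) = of_int (2 * ?w r)" for r
  proof -
    have x: "pi * real (r * p ^ l) / real n = real r * (pi / 2)" using prime_gt_0_nat[OF p(1)] by (simp add: n)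
    show ?thesis
    proof (cases "odd r")
      case True
      then have "cos (real r * (pi / 2)) = 0" unfolding cos_zero_iff by blast
      then show ?thesis using True unfolding path_eigenvalue_def x by simp
    next
      case False
      then obtain s where s: "r = 2 * s" by (auto elim: evenE)
      have "real r * (pi / 2) = real s * pi" unfolding s by simp
      moreover have "4 dvd r \<longleftrightarrow> even s" unfolding s by presburger
      ultimately show ?thesis using False unfolding path_eigenvalue_def x by simp
    qed
  qed
  show "?w r = of_bool (odd r)" if "r < n" "path_eigenvector n r a \<noteq> 0" for r
  proof -
    have False if r: "even r" "\<not> 4 dvd r"
    proof -
      obtain s where s: "r = 2 * s" using r by (auto elim: evenE)
      have "odd s" using r unfolding s by presburger
      obtain i where i: "2 * a - 1 = p ^ l * i" using dvd by (auto elim: dvdE)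
      have "odd (2 * a - 1)" using a by simp
      then have "odd i" unfolding i by simp
      have "r * (2 * a - 1) = (s * i) * n" unfolding s i n by simp
      then have "path_eigenvector n r a = 0"
        using path_eigenvector_eq_0_iff[of n a r] n1 a \<open>odd s\<close> \<open>odd i\<close> by fastforce
      then show False using \<open>path_eigenvector n r a \<noteq> 0\<close> by simp
    qed
    then show ?thesis by auto
  qed
qed

theorem theorem1p2:
  fixes n a :: nat
  assumes "n \<ge> 2" and "a \<in> {1..n}"
  shows "proper_laplacian_PGFR (path_graph n) a (n + 1 - a) \<longleftrightarrow>
    (\<exists>(p::nat) (l::nat). prime p \<and> l \<ge> 1 \<and> n = p ^ l \<and> real a \<noteq> (real p ^ l + 1) / 2) \<or>
    (\<exists>(p::nat) (l::nat). prime p \<and> odd p \<and> l \<ge> 1 \<and> n = 2 * p ^ l \<and>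
       (real a = (real p ^ l + 1) / 2 \<or> real a = (3 * real p ^ l + 1) / 2))"
proof -
  \<comment> \<open>The midpoints are real numbers, possibly half-integers; doubling moves the
    conditions to the naturals.\<close>
  have half1: "real a = (real p ^ l + 1) / 2 \<longleftrightarrow> 2 * a = p ^ l + 1" for p l :: nat
  proof -
    have "real a = (real p ^ l + 1) / 2 \<longleftrightarrow> 2 * real a = real p ^ l + 1" by auto
    also have "\<dots> \<longleftrightarrow> real (2 * a) = real (p ^ l + 1)" by (simp add: add.commute)
    finally show ?thesis by (simp only: of_nat_eq_iff)
  qed
  have half3: "real a = (3 * real p ^ l + 1) / 2 \<longleftrightarrow> 2 * a = 3 * p ^ l + 1" for p l :: nat
  proof -
    have "real a = (3 * real p ^ l + 1) / 2 \<longleftrightarrow> 2 * real a = 3 * real p ^ l + 1" by auto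
    also have "\<dots> \<longleftrightarrow> real (2 * a) = real (3 * p ^ l + 1)" by (simp add: add.commute)
    finally show ?thesis by (simp only: of_nat_eq_iff)
  qed
  show ?thesis
    unfolding half1 half3
  proof
    assume "proper_laplacian_PGFR (path_graph n) a (n + 1 - a)"
    from proper_PGFR_path_necessary[OF assms this]
    consider (1) p l where "2 * a \<noteq> n + 1" "prime p" "l \<ge> 1" "n = p ^ l"
      | (2) p l where "prime p" "odd p" "l \<ge> 1" "n = 2 * p ^ l" "p ^ l dvd 2 * a - 1"
      by blast
    then show "(\<exists>p l. prime p \<and> l \<ge> 1 \<and> n = p ^ l \<and> 2 * a \<noteq> p ^ l + 1) \<or>
      (\<exists>p l. prime p \<and> odd p \<and> l \<ge> 1 \<and> n = 2 * p ^ l \<and> (2 * a = p ^ l + 1 \<or> 2 * a = 3 * p ^ l + 1))"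
    proof cases
      case 1
      then show ?thesis by blast
    next
      case 2
      obtain i where i: "2 * a - 1 = p ^ l * i" using 2(5) by (auto elim: dvdE)
      \<comment> \<open>The cofactor of \<open>p ^ l\<close> in \<open>2 * a - 1\<close> is odd and
        below 4; its values 1 and 3 are the two positions of \<open>a\<close>.\<close>
      have "a \<ge> 1" "a \<le> 2 * p ^ l" using assms(2) 2(4) by auto
      then have "odd (2 * a - 1)" "p ^ l * i < p ^ l * 4" unfolding i[symmetric] by auto
      then have "odd i" "i < 4" unfolding i by auto
      then have "i = 1 \<or> i = 3" by presburger
      then have "2 * a = p ^ l + 1 \<or> 2 * a = 3 * p ^ l + 1" using i \<open>a \<ge> 1\<close> by auto
      then show ?thesis using 2 by blast
    qed
  next
    assume "(\<exists>p l. prime p \<and> l \<ge> 1 \<and> n = p ^ l \<and> 2 * a \<noteq> p ^ l + 1) \<or>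
      (\<exists>p l. prime p \<and> odd p \<and> l \<ge> 1 \<and> n = 2 * p ^ l \<and> (2 * a = p ^ l + 1 \<or> 2 * a = 3 * p ^ l + 1))"
    then consider (1) p l where "prime p" "l \<ge> 1" "n = p ^ l" "2 * a \<noteq> p ^ l + 1"
      | (2) p l where "prime p" "odd p" "n = 2 * p ^ l" "2 * a = p ^ l + 1 \<or> 2 * a = 3 * p ^ l + 1"
      by blast
    then show "proper_laplacian_PGFR (path_graph n) a (n + 1 - a)"
    proof cases
      case 1
      show ?thesis
      proof (cases "p = 2")
        case True
        then show ?thesis using proper_PGFR_path_power_of_2 1 assms(2) by simp
      next
        case False
        then have "odd p" using 1(1) primes_dvd_imp_eq two_is_prime_nat by blast
        then show ?thesis using proper_PGFR_path_odd_prime_power[OF 1(1) _ 1(3) assms(2)] 1 by simp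
      qed
    next
      case 2
      then have "2 * a - 1 = p ^ l \<or> 2 * a - 1 = 3 * p ^ l" by auto
      then have "p ^ l dvd 2 * a - 1" by auto
      then show ?thesis using proper_PGFR_path_twice_odd_prime_power 2 assms(2) by blast
    qed
  qed
qed

end
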